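(* Let $C\subset\mathbb{R}^n$ be a nonempty closed semi-algebraic set. Assume that $\nu$ is a semi-algebraic norm on $\mathbb{R}^n$ such that $\nu$ and its dual norm $\nu^*$ are differentiable. Let $S(C)$ be the set of all points $\mathbf{x}\in\mathbb{R}^n\setminus C$ at which the best $\nu$-approximation to $\mathbf{x}$ in $C$ is not unique. Then $S(C)$ is a semi-algebraic set which does not contain a nonempty open set. In particular, $S(C)$ is contained in some hypersurface $H\subset\mathbb{R}^n$.
   Context: A point $\mathbf{y}^\star\in C$ is a best $\nu$-approximation to $\mathbf{x}$ in $C$ if $\nu(\mathbf{x}-\mathbf{y}^\star)=\mathrm{dist}_\nu(\mathbf{x},C):=\min\{\nu(\mathbf{x}-\mathbf{y}):\mathbf{y}\in C\}$. The dual norm is $\nu^*(\mathbf{x})=\max\{\mathbf{y}^\top\mathbf{x}:\nu(\mathbf{y})=1\}$. A norm is called differentiable if it is differentiable on $\mathbb{R}^n\setminus\{\mathbf{0}\}$. A set $S\subset\mathbb{R}^n$ is semi-algebraic if it is a finite union of sets each given by finitely many polynomial equalities $p_i(\mathbf{x})=0$ and polynomial inequalities $q_j(\mathbf{x})>0$. A function $f:\mathbb{R}^n\to\mathbb{R}$ is semi-algebraic if its graph is a semi-algebraic set; a norm is semi-algebraic if it is so as a function. A hypersurface in $\mathbb{R}^n$ is the zero set of a nonconstant real polynomial. *)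

theory Defs
  imports "HOL-Analysis.Analysis"
begin

(* A product 'a \<times> real of Euclidean spaces is again a Euclidean space, so one definition covers
   both subsets of R^n and graphs in R^n \<times> R = R^(n+1). Polynomials are represented by their
   evaluation functions, which over the infinite field of reals loses nothing. *)

definition basic_semialgebraic :: "'a::euclidean_space set \<Rightarrow> bool" where
  "basic_semialgebraic A \<longleftrightarrow>
    (\<exists>P Q. finite P \<and> finite Q \<and>
       (\<forall>p \<in> P. real_polynomial_function p) \<and> (\<forall>q \<in> Q. real_polynomial_function q) \<and>
       A = {x. (\<forall>p \<in> P. p x = 0) \<and> (\<forall>q \<in> Q. q x > 0)})"

definition semialgebraic :: "'a::euclidean_space set \<Rightarrow> bool" where
  "semialgebraic S \<longleftrightarrow> (\<exists>F. finite F \<and> (\<forall>A \<in> F. basic_semialgebraic A) \<and> S = \<Union>F)"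

definition semialgebraic_function :: "('a::euclidean_space \<Rightarrow> real) \<Rightarrow> bool" where
  "semialgebraic_function f \<longleftrightarrow> semialgebraic {(x, t). t = f x}"

definition hypersurface :: "'a::euclidean_space set \<Rightarrow> bool" where
  "hypersurface H \<longleftrightarrow>
    (\<exists>p. real_polynomial_function p \<and> \<not> p constant_on UNIV \<and> H = {x. p x = 0})"

definition is_norm :: "('a::real_vector \<Rightarrow> real) \<Rightarrow> bool" where
  "is_norm \<nu> \<longleftrightarrow>
    (\<forall>x. \<nu> x \<ge> 0) \<and> (\<forall>x. \<nu> x = 0 \<longleftrightarrow> x = 0) \<and>
    (\<forall>c x. \<nu> (c *\<^sub>R x) = \<bar>c\<bar> * \<nu> x) \<and> (\<forall>x y. \<nu> (x + y) \<le> \<nu> x + \<nu> y)"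

(* This supremum is a maximum: see dual_norm_attained. *)
definition dual_norm :: "('a::euclidean_space \<Rightarrow> real) \<Rightarrow> 'a \<Rightarrow> real" where
  "dual_norm \<nu> x = (SUP y \<in> {y. \<nu> y = 1}. y \<bullet> x)"

(* For nonempty closed C this infimum is a minimum: see norm_setdist_attained. *)
definition norm_setdist :: "('a::real_vector \<Rightarrow> real) \<Rightarrow> 'a \<Rightarrow> 'a set \<Rightarrow> real" where
  "norm_setdist \<nu> x C = (INF y \<in> C. \<nu> (x - y))"

definition best_approximation :: "('a::real_vector \<Rightarrow> real) \<Rightarrow> 'a set \<Rightarrow> 'a \<Rightarrow> 'a \<Rightarrow> bool" where
  "best_approximation \<nu> C x y \<longleftrightarrow> y \<in> C \<and> \<nu> (x - y) = norm_setdist \<nu> x C"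

definition nonunique_points :: "('a::real_vector \<Rightarrow> real) \<Rightarrow> 'a set \<Rightarrow> 'a set" where
  "nonunique_points \<nu> C =
    {x. x \<notin> C \<and>
        (\<exists>y z. best_approximation \<nu> C x y \<and> best_approximation \<nu> C x z \<and> y \<noteq> z)}"

lemma is_norm_continuous_on:
  fixes \<nu> :: "'a::euclidean_space \<Rightarrow> real"
  assumes "is_norm \<nu>"
  shows "continuous_on S \<nu>"
proof -
  have "convex_on UNIV \<nu>"
  proof (rule convex_onI)
    fix t :: real and x y :: 'a
    assume t: "t > 0" "t < 1"
    have "\<nu> ((1 - t) *\<^sub>R x + t *\<^sub>R y) \<le> \<nu> ((1 - t) *\<^sub>R x) + \<nu> (t *\<^sub>R y)"
      using assms unfolding is_norm_def by blast
    also have "\<dots> = (1 - t) * \<nu> x + t * \<nu> y"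
      using assms t unfolding is_norm_def by simp
    finally show "\<nu> ((1 - t) *\<^sub>R x + t *\<^sub>R y) \<le> (1 - t) * \<nu> x + t * \<nu> y" .
  qed simp
  then have "continuous_on UNIV \<nu>" by (rule convex_on_continuous[OF open_UNIV])
  then show ?thesis by (rule continuous_on_subset) simp
qed

lemma is_norm_lower_bound:
  fixes \<nu> :: "'a::euclidean_space \<Rightarrow> real"
  assumes "is_norm \<nu>"
  obtains m where "m > 0" "\<And>x. m * norm x \<le> \<nu> x"
proof -
  obtain b :: 'a where "b \<in> Basis" using nonempty_Basis by blast
  then have "sphere (0::'a) 1 \<noteq> {}" by (auto intro!: exI[of _ b])
  then obtain u where u: "u \<in> sphere 0 1" "\<And>y. y \<in> sphere 0 1 \<Longrightarrow> \<nu> u \<le> \<nu> y"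
    using continuous_attains_inf[OF compact_sphere _ is_norm_continuous_on[OF assms]] by metis
  have "u \<noteq> 0" using u(1) by auto
  then have "\<nu> u > 0" using assms unfolding is_norm_def by (metis less_eq_real_def)
  moreover have "\<nu> u * norm x \<le> \<nu> x" for x
  proof (cases "x = 0")
    case False
    have "\<nu> u \<le> \<nu> ((1 / norm x) *\<^sub>R x)" using False by (intro u(2)) simp
    also have "\<dots> = \<nu> x / norm x" using assms unfolding is_norm_def by simp
    finally show ?thesis using False by (simp add: field_simps)
  qed (use assms in \<open>simp add: is_norm_def\<close>)
  ultimately show thesis by (rule that)
qed

lemma is_norm_compact_sublevel:
  fixes \<nu> :: "'a::euclidean_space \<Rightarrow> real"
  assumes "is_norm \<nu>"
  shows "compact {y. \<nu> (x - y) \<le> r}"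
proof -
  obtain m where m: "m > 0" "\<And>x. m * norm x \<le> \<nu> x"
    using is_norm_lower_bound[OF assms] by blast
  have "continuous_on UNIV (\<lambda>y. \<nu> (x - y))"
    by (rule continuous_on_compose2[OF is_norm_continuous_on[OF assms, of UNIV]])
      (auto intro!: continuous_intros)
  then have "closed {y. \<nu> (x - y) \<le> r}" by (intro closed_Collect_le) auto
  moreover have "{y. \<nu> (x - y) \<le> r} \<subseteq> cball x (r / m)"
  proof
    fix y assume "y \<in> {y. \<nu> (x - y) \<le> r}"
    then have "m * norm (x - y) \<le> r" using m(2)[of "x - y"] by simp
    then show "y \<in> cball x (r / m)" using m(1) by (simp add: dist_norm field_simps)
  qed
  ultimately show ?thesis
    using bounded_subset[OF bounded_cball] by (auto simp: compact_eq_bounded_closed)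
qed

lemma dual_norm_attained:
  fixes \<nu> :: "'a::euclidean_space \<Rightarrow> real"
  assumes "is_norm \<nu>"
  shows "\<exists>y. \<nu> y = 1 \<and> y \<bullet> x = dual_norm \<nu> x \<and> (\<forall>z. \<nu> z = 1 \<longrightarrow> z \<bullet> x \<le> dual_norm \<nu> x)"
proof -
  let ?S = "{y. \<nu> y = 1}"
  have minus: "\<nu> (- y) = \<nu> y" for y
    using assms unfolding is_norm_def by (metis abs_1 abs_minus mult_1 scaleR_minus1_left)
  have "compact {y. \<nu> y \<le> 1}"
    using is_norm_compact_sublevel[OF assms, of 0 1] by (simp add: minus)
  moreover have "closed ?S"
    using closed_Collect_eq[OF is_norm_continuous_on[OF assms] continuous_on_const] .
  moreover have "?S = {y. \<nu> y \<le> 1} \<inter> ?S" by auto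
  ultimately have "compact ?S" by (metis compact_Int_closed)
  obtain b :: 'a where "b \<in> Basis" using nonempty_Basis by blast
  then have "\<nu> b > 0" using assms unfolding is_norm_def by (metis less_eq_real_def nonzero_Basis)
  then have "\<nu> ((1 / \<nu> b) *\<^sub>R b) = 1"
    using assms nonzero_Basis[OF \<open>b \<in> Basis\<close>] unfolding is_norm_def by simp
  then have "?S \<noteq> {}" by blast
  have "continuous_on ?S (\<lambda>z. z \<bullet> x)" by (intro continuous_intros)
  then obtain y where y: "y \<in> ?S" "\<forall>z \<in> ?S. z \<bullet> x \<le> y \<bullet> x"
    using continuous_attains_sup[OF \<open>compact ?S\<close> \<open>?S \<noteq> {}\<close>, of "\<lambda>z. z \<bullet> x"] by blast
  have "dual_norm \<nu> x = y \<bullet> x"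
    unfolding dual_norm_def using y by (intro cSup_eq_maximum) auto
  then show ?thesis using y by auto
qed

lemma norm_setdist_attained:
  fixes \<nu> :: "'a::euclidean_space \<Rightarrow> real"
  assumes "is_norm \<nu>" "closed C" "C \<noteq> {}"
  shows "\<exists>y \<in> C. \<nu> (x - y) = norm_setdist \<nu> x C \<and> (\<forall>z \<in> C. norm_setdist \<nu> x C \<le> \<nu> (x - z))"
proof -
  obtain y0 where y0: "y0 \<in> C" using assms(3) by blast
  let ?K = "{y. \<nu> (x - y) \<le> \<nu> (x - y0)} \<inter> C"
  have "compact ?K" using is_norm_compact_sublevel[OF assms(1)] assms(2) by (rule compact_Int_closed)
  moreover have "?K \<noteq> {}" using y0 by blast
  moreover have "continuous_on ?K (\<lambda>y. \<nu> (x - y))"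
    by (rule continuous_on_compose2[OF is_norm_continuous_on[OF assms(1), of UNIV]])
      (auto intro!: continuous_intros)
  ultimately obtain y where y: "y \<in> ?K" "\<forall>z \<in> ?K. \<nu> (x - y) \<le> \<nu> (x - z)"
    using continuous_attains_inf by meson
  have min: "\<nu> (x - y) \<le> \<nu> (x - z)" if "z \<in> C" for z
  proof (cases "\<nu> (x - z) \<le> \<nu> (x - y0)")
    case True
    then show ?thesis using y(2) that by blast
  next
    case False
    then show ?thesis using y(1) by simp
  qed
  have "norm_setdist \<nu> x C = \<nu> (x - y)"
    unfolding norm_setdist_def using y(1) min by (intro cInf_eq_minimum) auto
  then show ?thesis using y(1) min by auto
qed

end

theory Submission
  imports Defs
begin

text \<open>
  Write \<open>S\<close> for the set of points outside \<open>C\<close> with several best approximations. Three facts of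
  different nature are combined.

  \<^item> \<open>S\<close> is semi-algebraic because it is defined by a first-order formula over the semi-algebraic data
  \<open>C\<close> and \<open>\<nu>\<close> (\<open>semialgebraic_nonunique_points\<close>), and semi-algebraic sets are closed under
  projection (\<open>semialgebraic_projection\<close>, the Tarski-Seidenberg theorem).

  \<^item> \<open>S\<close> contains no nonempty open set. Differentiability of \<open>\<nu>\<close> and of its dual makes \<open>\<nu>\<close> strictly
  convex (\<open>smooth_dual_imp_strictly_convex\<close>): a functional that norms the sum of two vectors with
  equality in the triangle inequality norms both, and the derivative of the dual norm leaves room
  for one normed unit vector only. Strict convexity implies that a point on the open segment from
  \<open>x \<notin> C\<close> to a best approximation \<open>y\<close> has no best approximation but \<open>y\<close>
  (\<open>unique_best_approximation_towards_projection\<close>), and such points are arbitrarily close to \<open>x\<close>.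

  \<^item> A semi-algebraic set with empty interior lies in a hypersurface
  (\<open>thin_semialgebraic_subset_hypersurface\<close>): each nonempty basic piece satisfies a nontrivial equation,
  for otherwise it would be open.

  The projection theorem is proved by matching roots, in the manner of Cohen, Hoermander and Muchnik.
  A set is semi-algebraic iff membership depends only on the signs of finitely many polynomials.
  For a set in the product of the parameter space with the line, these polynomials are univariate with
  coefficients depending polynomially on a parameter. They are enlarged to a finite family
  closed under derivatives, removal of leading terms and pseudo-remainders
  (\<open>closed_family_exists\<close>). If two parameters give equal signs to the leading coefficients of this
  family, the roots of its members over the two parameters correspond in an order-preserving way that
  also respects all signs (\<open>family_match_exists\<close>). The correspondence is built by increasing degree:
  remainders give the signs of a new polynomial at the roots already matched, and since it is
  monotone between these roots by its derivative, its own roots are located by its signs there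
  and near infinity (\<open>extend_order_matching\<close>). Hence the
  sign vectors attained along the line depend only on the signs of the leading coefficients
  (\<open>signs_determined_by_coefficients\<close>), and the projection is semi-algebraic.
\<close>

section \<open>Order matchings between finite sets of real points\<close>

text \<open>
  Here \<open>M\<close> is a finite table of pairs of corresponding points on two copies of the line.
  The points \<open>t\<close> and \<open>s\<close> lie in the same cell when \<open>t\<close> sits among the left-hand points of \<open>M\<close>
  as \<open>s\<close> sits among the right-hand ones, equality included. Using a table and the relation it
  induces, instead of an increasing bijection of the line, makes adding new pairs painless: a
  larger table only has a smaller relation.
\<close>
definition same_cut :: "(real \<times> real) set \<Rightarrow> real \<Rightarrow> real \<Rightarrow> bool" where
  "same_cut M t s \<longleftrightarrow> (\<forall>(a, b) \<in> M. sgn (t - a) = sgn (s - b))"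

text \<open>
  The table is the graph of a strictly increasing map between two finite sets.
\<close>
definition order_matching :: "(real \<times> real) set \<Rightarrow> bool" where
  "order_matching M \<longleftrightarrow> finite M \<and> (\<forall>(a, b) \<in> M. same_cut M a b)"

definition signs_match :: "(real \<times> real) set \<Rightarrow> real poly \<Rightarrow> real poly \<Rightarrow> bool" where
  "signs_match M p q \<longleftrightarrow> (\<forall>t s. same_cut M t s \<longrightarrow> sgn (poly p t) = sgn (poly q s))"

lemma sgn_real_eq_iff:
  "sgn x = sgn (y::real) \<longleftrightarrow> (x > 0 \<longleftrightarrow> y > 0) \<and> (x = 0 \<longleftrightarrow> y = 0)"
  by (auto simp: sgn_if)

lemma same_cutD:
  assumes "same_cut M t s" "(a, b) \<in> M"
  shows "t < a \<longleftrightarrow> s < b" "a < t \<longleftrightarrow> b < s" "t = a \<longleftrightarrow> s = b"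
  using assms unfolding same_cut_def by (auto simp: sgn_if split: if_splits)

lemma same_cut_converse: "same_cut (M\<inverse>) s t \<longleftrightarrow> same_cut M t s"
  unfolding same_cut_def by (auto simp: eq_commute)

lemma order_matching_converse: "order_matching M \<Longrightarrow> order_matching (M\<inverse>)"
  unfolding order_matching_def using same_cut_converse by auto

lemma signs_match_converse: "signs_match M p q \<Longrightarrow> signs_match (M\<inverse>) q p"
  unfolding signs_match_def using same_cut_converse by (metis)

lemma strictly_between_finite_sets:
  fixes L U :: "real set"
  assumes "finite L" "finite U" and "\<And>l u. l \<in> L \<Longrightarrow> u \<in> U \<Longrightarrow> l < u"
  shows "\<exists>s. (\<forall>l \<in> L. l < s) \<and> (\<forall>u \<in> U. s < u)"
proof (cases "L = {} \<or> U = {}")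
  case True
  obtain B where B: "\<forall>u \<in> L \<union> U. \<bar>u\<bar> \<le> B"
    using finite_imp_bounded[of "L \<union> U"] assms(1,2) unfolding bounded_iff by auto
  from True show ?thesis
  proof
    assume "L = {}"
    then show ?thesis using B by (intro exI[of _ "- B - 1"]) fastforce
  next
    assume "U = {}"
    then show ?thesis using B by (intro exI[of _ "B + 1"]) fastforce
  qed
next
  case False
  then have "Max L < Min U" using assms by simp
  then obtain s where "Max L < s" "s < Min U" using dense by blast
  then show ?thesis using False assms(1,2) by (intro exI[of _ s]) auto
qed

text \<open>
  Every cell on the left has a nonempty partner on the right, because the order of the line
  is dense and has no end points. This is what finally turns a matching of roots into a
  statement about all points.
\<close>
lemma same_cut_exists:
  assumes "order_matching M"
  obtains s where "same_cut M t s"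
proof (cases "\<exists>b. (t, b) \<in> M")
  case True
  then show thesis using assms that unfolding order_matching_def by blast
next
  case False
  have M: "finite M" "\<And>a b. (a, b) \<in> M \<Longrightarrow> same_cut M a b"
    using assms unfolding order_matching_def by auto
  let ?L = "snd ` {z \<in> M. fst z < t}" and ?U = "snd ` {z \<in> M. t < fst z}"
  have fin: "finite ?L" "finite ?U" using M(1) by simp_all
  have lt: "l < u" if lu: "l \<in> ?L" "u \<in> ?U" for l u
  proof -
    obtain a c where ac: "(a, l) \<in> M" "a < t" "(c, u) \<in> M" "t < c"
      using lu by auto
    have "a < c" using ac by simp
    then show ?thesis using same_cutD(1)[OF M(2)[OF ac(1)] ac(3)] by simp
  qed
  obtain s where s: "\<forall>l \<in> ?L. l < s" "\<forall>u \<in> ?U. s < u"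
    using strictly_between_finite_sets[OF fin lt] by blast
  have "sgn (t - a) = sgn (s - b)" if ab: "(a, b) \<in> M" for a b
  proof -
    have "a \<noteq> t" using False ab by auto
    then consider "a < t" | "t < a" by linarith
    then show ?thesis
    proof cases
      case 1
      then have "b < s" using s(1) ab by force
      then show ?thesis using 1 by simp
    next
      case 2
      then have "s < b" using s(2) ab by force
      then show ?thesis using 2 by simp
    qed
  qed
  then have "same_cut M t s" unfolding same_cut_def by auto
  then show thesis by (rule that)
qed

section \<open>Extending a matching of roots by the roots of one more polynomial\<close>

lemma poly_less_of_pderiv_pos:
  fixes p :: "real poly"
  assumes "\<And>z. l < z \<Longrightarrow> z < r \<Longrightarrow> poly (pderiv p) z > 0" and "l \<le> u" "u < v" "v \<le> r"
  shows "poly p u < poly p v"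
proof (rule DERIV_pos_imp_increasing_open[OF \<open>u < v\<close>])
  fix z assume "u < z" "z < v"
  then show "\<exists>y. DERIV (poly p) z :> y \<and> 0 < y"
    using assms poly_DERIV[of p z] by (meson le_less_trans less_le_trans)
qed (auto intro!: continuous_intros)

text \<open>
  On an interval where a polynomial increases, whether it has a root inside is read off from its
  signs at the two ends; equal end signs therefore give a root on both sides or on none.
\<close>
lemma increasing_gap_root:
  fixes p q :: "real poly"
  assumes p': "\<And>z. l < z \<Longrightarrow> z < r \<Longrightarrow> poly (pderiv p) z > 0"
    and a: "l < a" "a < r" "poly p a = 0" and "l' < r'"
    and l: "sgn (poly p l) = sgn (poly q l')" and r: "sgn (poly p r) = sgn (poly q r')"
  shows "\<exists>b. l' < b \<and> b < r' \<and> poly q b = 0"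
proof -
  have "poly p l < 0" "poly p r > 0"
    using poly_less_of_pderiv_pos[OF p', where u = l and v = a and l = l and r = r] 
      poly_less_of_pderiv_pos[OF p', where u = a and v = r and l = l and r = r] a by auto
  then have "poly q l' < 0" "poly q r' > 0"
    using l r by (auto simp: sgn_if split: if_splits)
  then show ?thesis using poly_IVT_pos[OF \<open>l' < r'\<close>] by auto
qed

text \<open>
  The sign at an interior point is forced by the end signs, except when the polynomial changes sign
  inside; then it is the side of the unique interior root that counts.
\<close>
lemma increasing_gap_sign:
  fixes p q :: "real poly"
  assumes p': "\<And>z. l < z \<Longrightarrow> z < r \<Longrightarrow> poly (pderiv p) z > 0"
    and q': "\<And>z. l' < z \<Longrightarrow> z < r' \<Longrightarrow> poly (pderiv q) z > 0"
    and t: "l < t" "t < r" and s: "l' < s" "s < r'"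
    and l: "sgn (poly p l) = sgn (poly q l')" and r: "sgn (poly p r) = sgn (poly q r')"
    and roots: "\<And>a b. \<lbrakk>l < a; a < r; l' < b; b < r'; poly p a = 0; poly q b = 0\<rbrakk>
                  \<Longrightarrow> sgn (t - a) = sgn (s - b)"
  shows "sgn (poly p t) = sgn (poly q s)"
proof -
  note pm = poly_less_of_pderiv_pos[OF p', where l = l and r = r]
  note qm = poly_less_of_pderiv_pos[OF q', where l = l' and r = r']
  consider "poly p l \<ge> 0" | "poly p r \<le> 0" | "poly p l < 0" "poly p r > 0" by linarith
  then show ?thesis
  proof cases
    case 1
    then have "poly q l' \<ge> 0" using l by (auto simp: sgn_if split: if_splits)
    then have "poly p t > 0" "poly q s > 0" using 1 pm[of l t] qm[of l' s] t s by auto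
    then show ?thesis by simp
  next
    case 2
    then have "poly q r' \<le> 0" using r by (auto simp: sgn_if split: if_splits)
    then have "poly p t < 0" "poly q s < 0" using 2 pm[of t r] qm[of s r'] t s by auto
    then show ?thesis by simp
  next
    case 3
    then have q3: "poly q l' < 0" "poly q r' > 0"
      using l r by (auto simp: sgn_if split: if_splits)
    obtain a where a: "l < a" "a < r" "poly p a = 0" using poly_IVT_pos[of l r p] 3 t by auto
    obtain b where b: "l' < b" "b < r'" "poly q b = 0" using poly_IVT_pos[of l' r' q] q3 s by auto
    have "sgn (poly p t) = sgn (t - a)"
      using pm[of t a] pm[of a t] a t by (cases t a rule: linorder_cases) auto
    moreover have "sgn (poly q s) = sgn (s - b)"
      using qm[of s b] qm[of b s] b s by (cases s b rule: linorder_cases) auto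
    ultimately show ?thesis using roots[OF a(1,2) b(1,2) a(3) b(3)] by simp
  qed
qed

text \<open>
  Negating both polynomials reduces decreasing pairs to increasing ones.
\<close>
lemma monotone_gap_wlog:
  fixes p q :: "real poly"
  assumes p': "\<And>z. l < z \<Longrightarrow> z < r \<Longrightarrow> sgn (poly (pderiv p) z) = e"
    and q': "\<And>z. l' < z \<Longrightarrow> z < r' \<Longrightarrow> sgn (poly (pderiv q) z) = e"
    and "e \<noteq> 0"
  shows "\<exists>P Q. (P = p \<and> Q = q \<or> P = -p \<and> Q = -q) \<and>
    (\<forall>z. l < z \<longrightarrow> z < r \<longrightarrow> poly (pderiv P) z > 0) \<and>
    (\<forall>z. l' < z \<longrightarrow> z < r' \<longrightarrow> poly (pderiv Q) z > 0)"
proof (cases "e > 0")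
  case True
  have "poly (pderiv p) z > 0" if "l < z" "z < r" for z using p'[OF that] True by (metis sgn_greater)
  moreover have "poly (pderiv q) z > 0" if "l' < z" "z < r'" for z
    using q'[OF that] True by (metis sgn_greater)
  ultimately show ?thesis by blast
next
  case False
  then have "e < 0" using assms(3) by simp
  then have "poly (pderiv p) z < 0" if "l < z" "z < r" for z
    using p'[OF that] \<open>e < 0\<close> by (metis sgn_less)
  moreover have "poly (pderiv q) z < 0" if "l' < z" "z < r'" for z
    using q'[OF that] \<open>e < 0\<close> by (metis sgn_less)
  ultimately show ?thesis by (intro exI[of _ "-p"] exI[of _ "-q"]) (auto simp: pderiv_minus)
qed

lemma monotone_gap_root:
  fixes p q :: "real poly"
  assumes p': "\<And>z. l < z \<Longrightarrow> z < r \<Longrightarrow> sgn (poly (pderiv p) z) = e"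
    and q': "\<And>z. l' < z \<Longrightarrow> z < r' \<Longrightarrow> sgn (poly (pderiv q) z) = e"
    and "e \<noteq> 0" and "l' < r'"
    and ends: "sgn (poly p l) = sgn (poly q l')" "sgn (poly p r) = sgn (poly q r')"
    and a: "l < a" "a < r" "poly p a = 0"
  shows "\<exists>b. l' < b \<and> b < r' \<and> poly q b = 0"
proof -
  obtain P Q where PQ: "P = p \<and> Q = q \<or> P = -p \<and> Q = -q"
    "\<And>z. l < z \<Longrightarrow> z < r \<Longrightarrow> poly (pderiv P) z > 0"
    using monotone_gap_wlog[of l r p e l' r' q, OF p' q' \<open>e \<noteq> 0\<close>] by blast
  have "sgn (poly P l) = sgn (poly Q l')" "sgn (poly P r) = sgn (poly Q r')" "poly P a = 0"
    using PQ(1) ends a(3) by (auto simp: sgn_minus)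
  then have "\<exists>b. l' < b \<and> b < r' \<and> poly Q b = 0"
    using increasing_gap_root[OF PQ(2) a(1,2) _ \<open>l' < r'\<close>] by blast
  then show ?thesis using PQ(1) by auto
qed

lemma monotone_gap_sign:
  fixes p q :: "real poly"
  assumes p': "\<And>z. l < z \<Longrightarrow> z < r \<Longrightarrow> sgn (poly (pderiv p) z) = e"
    and q': "\<And>z. l' < z \<Longrightarrow> z < r' \<Longrightarrow> sgn (poly (pderiv q) z) = e"
    and "e \<noteq> 0"
    and ends: "sgn (poly p l) = sgn (poly q l')" "sgn (poly p r) = sgn (poly q r')"
    and ts: "l < t" "t < r" "l' < s" "s < r'"
    and roots: "\<And>a b. \<lbrakk>l < a; a < r; l' < b; b < r'; poly p a = 0; poly q b = 0\<rbrakk>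
                  \<Longrightarrow> sgn (t - a) = sgn (s - b)"
  shows "sgn (poly p t) = sgn (poly q s)"
proof -
  obtain P Q where PQ: "P = p \<and> Q = q \<or> P = -p \<and> Q = -q"
    "\<And>z. l < z \<Longrightarrow> z < r \<Longrightarrow> poly (pderiv P) z > 0"
    "\<And>z. l' < z \<Longrightarrow> z < r' \<Longrightarrow> poly (pderiv Q) z > 0"
    using monotone_gap_wlog[of l r p e l' r' q, OF p' q' \<open>e \<noteq> 0\<close>] by blast
  have e: "sgn (poly P l) = sgn (poly Q l')" "sgn (poly P r) = sgn (poly Q r')"
    using PQ(1) ends by (auto simp: sgn_minus)
  have "sgn (poly P t) = sgn (poly Q s)"
    by (rule increasing_gap_sign[OF PQ(2,3) ts e]) (use roots PQ(1) in auto)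
  then show ?thesis using PQ(1) by (auto simp: sgn_minus)
qed

lemma poly_sign_near_pinfty:
  fixes p :: "real poly"
  shows "\<exists>B. \<forall>z\<ge>B. sgn (poly p z) = sgn (lead_coeff p)"
proof (cases "lead_coeff p" "0::real" rule: linorder_cases)
  case greater
  then obtain B where "\<And>z. z \<ge> B \<Longrightarrow> lead_coeff p \<le> poly p z"
    using poly_pinfty_gt_lc by blast
  then have "poly p z > 0" if "z \<ge> B" for z using greater that by (meson less_le_trans)
  then show ?thesis using greater by (metis sgn_pos)
next
  case equal
  then show ?thesis by simp
next
  case less
  then have "lead_coeff (- p) > 0" by simp
  then obtain B where "\<And>z. z \<ge> B \<Longrightarrow> lead_coeff (- p) \<le> poly (- p) z"
    using poly_pinfty_gt_lc by blast
  then have "poly p z < 0" if "z \<ge> B" for z using less that by force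
  then show ?thesis using less by (metis sgn_neg)
qed

lemma poly_sign_near_minfty:
  fixes p :: "real poly"
  shows "\<exists>B. \<forall>z\<le>-B. sgn (poly p z) = sgn (lead_coeff p) * (-1) ^ degree p"
proof -
  let ?q = "pcompose p [:0, -1:]"
  obtain B where B: "\<forall>z\<ge>B. sgn (poly ?q z) = sgn (lead_coeff ?q)"
    using poly_sign_near_pinfty by blast
  have "lead_coeff ?q = lead_coeff p * (-1) ^ degree p"
    by (subst lead_coeff_comp) auto
  then have "sgn (poly p z) = sgn (lead_coeff p) * (-1) ^ degree p" if "z \<le> -B" for z
    using B[rule_format, of "-z"] that by (simp add: poly_pcompose sgn_mult power_sgn[symmetric])
  then show ?thesis by blast
qed

text \<open>
  The two unbounded cells are treated as bounded ones by cutting them off at \<open>-B\<close> and \<open>B\<close>, where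
  degree and leading coefficient already decide the signs.
\<close>
lemma common_signs_far_out:
  fixes p q :: "real poly"
  assumes "degree p = degree q" "sgn (lead_coeff p) = sgn (lead_coeff q)"
  obtains B where "\<And>z w. \<bar>z\<bar> \<ge> B \<Longrightarrow> \<bar>w\<bar> \<ge> B \<Longrightarrow> sgn z = sgn w \<Longrightarrow> sgn (poly p z) = sgn (poly q w)"
proof -
  obtain B1 B2 B3 B4 where B:
    "\<forall>z\<ge>B1. sgn (poly p z) = sgn (lead_coeff p)"
    "\<forall>z\<ge>B2. sgn (poly q z) = sgn (lead_coeff q)"
    "\<forall>z\<le>-B3. sgn (poly p z) = sgn (lead_coeff p) * (-1) ^ degree p"
    "\<forall>z\<le>-B4. sgn (poly q z) = sgn (lead_coeff q) * (-1) ^ degree q"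
    using poly_sign_near_pinfty[of p] poly_sign_near_pinfty[of q]
      poly_sign_near_minfty[of p] poly_sign_near_minfty[of q] by blast
  let ?B = "max (max (max B1 B2) (max B3 B4)) 1"
  show thesis
  proof (rule that[of ?B])
    fix z w :: real assume zw: "\<bar>z\<bar> \<ge> ?B" "\<bar>w\<bar> \<ge> ?B" "sgn z = sgn w"
    have "z \<noteq> 0" using zw by auto
    show "sgn (poly p z) = sgn (poly q w)"
    proof (cases "z > 0")
      case True
      then have "w > 0" using zw(3) by (auto simp: sgn_if split: if_splits)
      then have "z \<ge> B1" "w \<ge> B2" using zw True by auto
      then show ?thesis using B(1,2) assms(2) by simp
    next
      case False
      then have "z < 0" using \<open>z \<noteq> 0\<close> by simp
      then have "w < 0" using zw(3) by (auto simp: sgn_if split: if_splits)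
      then have "z \<le> -B3" "w \<le> -B4" using zw \<open>z < 0\<close> by auto
      then show ?thesis using B(3,4) assms by simp
    qed
  qed
qed

lemma order_matching_mono:
  assumes "order_matching K" "(a, b) \<in> K" "(c, d) \<in> K"
  shows "a < c \<longleftrightarrow> b < d" "a = c \<longleftrightarrow> b = d"
  using assms same_cutD[of K a b c d] unfolding order_matching_def by auto

lemma order_matching_gap:
  assumes K: "order_matching K" and ts: "same_cut K t s" and t: "t \<notin> Domain K"
    and "\<exists>(a, b) \<in> K. a < t" and "\<exists>(a, b) \<in> K. t < a"
  shows "\<exists>l l' r r'. (l, l') \<in> K \<and> (r, r') \<in> K \<and> l < t \<and> t < r \<and> l' < s \<and> s < r' \<and>
    (\<forall>z w. l < z \<longrightarrow> z < r \<longrightarrow> l' < w \<longrightarrow> w < r' \<longrightarrow> same_cut K z w) \<and>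
    (\<forall>z. l < z \<longrightarrow> z < r \<longrightarrow> z \<notin> Domain K) \<and> (\<forall>w. l' < w \<longrightarrow> w < r' \<longrightarrow> w \<notin> Range K)"
proof -
  have fin: "finite K" using K unfolding order_matching_def by blast
  define L where "L = {a \<in> Domain K. a < t}"
  define R where "R = {a \<in> Domain K. t < a}"
  have LR: "finite L" "finite R" "L \<noteq> {}" "R \<noteq> {}"
    using fin assms(4,5) unfolding L_def R_def by (auto simp: finite_Domain)
  define l where "l = Max L"
  define r where "r = Min R"
  have "l \<in> L" "r \<in> R" unfolding l_def r_def using LR by auto
  then obtain l' r' where lr: "(l, l') \<in> K" "(r, r') \<in> K" "l < t" "t < r"
    unfolding L_def R_def by auto
  have out: "a \<le> l \<and> b \<le> l' \<or> r \<le> a \<and> r' \<le> b" if ab: "(a, b) \<in> K" for a b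
  proof -
    have "a \<noteq> t" using t ab by auto
    then have "a \<in> L \<or> a \<in> R" using ab unfolding L_def R_def by auto
    then have "a \<le> l \<or> r \<le> a" unfolding l_def r_def using LR by auto
    then show ?thesis
      using order_matching_mono[OF K ab lr(1)] order_matching_mono[OF K lr(2) ab]
      by (auto simp: le_less)
  qed
  have "l' < s" "s < r'"
    using same_cutD[OF ts lr(1)] same_cutD[OF ts lr(2)] lr(3,4) by auto
  moreover have "same_cut K z w" if "l < z" "z < r" "l' < w" "w < r'" for z w
    unfolding same_cut_def using out that by (fastforce simp: sgn_if)
  moreover have "z \<notin> Domain K" if "l < z" "z < r" for z using out that by force
  moreover have "w \<notin> Range K" if "l' < w" "w < r'" for w using out that by force
  ultimately show ?thesis using lr by blast
qed

lemma same_cut_Un: "same_cut (M \<union> N) t s \<longleftrightarrow> same_cut M t s \<and> same_cut N t s"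
  unfolding same_cut_def by blast

text \<open>
  A cell is enclosed between points at which \<open>p\<close> and \<open>q\<close> have equal signs. An unbounded cell gets
  its missing end from a far away entry that is added to the table for the proof.
\<close>
lemma gap_with_equal_end_signs:
  fixes p q :: "real poly"
  assumes M: "order_matching M" and ts: "same_cut M t s" and t: "t \<notin> Domain M"
    and lead: "degree p = degree q" "sgn (lead_coeff p) = sgn (lead_coeff q)"
    and at: "\<forall>(a, b) \<in> M. sgn (poly p a) = sgn (poly q b)"
  shows "\<exists>l l' r r'. l < t \<and> t < r \<and> l' < s \<and> s < r' \<and>
    sgn (poly p l) = sgn (poly q l') \<and> sgn (poly p r) = sgn (poly q r') \<and>
    (\<forall>z w. l < z \<longrightarrow> z < r \<longrightarrow> l' < w \<longrightarrow> w < r' \<longrightarrow> same_cut M z w) \<and>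
    (\<forall>z. l < z \<longrightarrow> z < r \<longrightarrow> z \<notin> Domain M) \<and> (\<forall>w. l' < w \<longrightarrow> w < r' \<longrightarrow> w \<notin> Range M)"
proof -
  have fin: "finite M" using M unfolding order_matching_def by blast
  obtain B where B: "\<And>z w. \<bar>z\<bar> \<ge> B \<Longrightarrow> \<bar>w\<bar> \<ge> B \<Longrightarrow> sgn z = sgn w \<Longrightarrow> sgn (poly p z) = sgn (poly q w)"
    using common_signs_far_out[OF lead] by blast
  obtain D where D: "\<forall>u \<in> Domain M \<union> Range M \<union> {t, s}. \<bar>u\<bar> \<le> D"
    using finite_imp_bounded[of "Domain M \<union> Range M \<union> {t, s}"] fin
    unfolding bounded_iff by (auto simp: finite_Domain finite_Range)
  define E where "E = max B D + 1"
  have E: "E > B" "E > 0" "\<And>u. u \<in> Domain M \<union> Range M \<union> {t, s} \<Longrightarrow> -E < u \<and> u < E"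
    using D unfolding E_def by (force+)
  \<comment> \<open>\<open>E\<close> exceeds all listed points and \<open>B\<close>, so the signs of \<open>p\<close> and \<open>q\<close> agree at the two new entries.\<close>
  define K where "K = M \<union> {(-E, -E), (E, E)}"
  have EM: "-E < a" "a < E" "-E < b" "b < E" if "(a, b) \<in> M" for a b
    using E(3)[of a] E(3)[of b] that by auto
  have "same_cut M a b" if "(a, b) \<in> M" for a b
    using M that unfolding order_matching_def by auto
  moreover have "same_cut {(-E, -E), (E, E)} a b" if "(a, b) \<in> M" for a b
    using EM[OF that] by (auto simp: same_cut_def sgn_if)
  moreover have "same_cut M a a" if a: "a = -E \<or> a = E" for a
    unfolding same_cut_def
  proof (clarify)
    fix c d assume "(c, d) \<in> M"
    from EM[OF this] a show "sgn (a - c) = sgn (a - d)" by (auto simp: sgn_if)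
  qed
  moreover have "same_cut {(-E, -E), (E, E)} a a" for a
    unfolding same_cut_def by auto
  ultimately have K: "order_matching K"
    unfolding order_matching_def using fin unfolding K_def same_cut_Un by auto
  have ts': "same_cut K t s"
    unfolding K_def same_cut_Un using ts E(3)[of t] E(3)[of s] by (auto simp: same_cut_def sgn_if)
  have t': "t \<notin> Domain K" using t E(3)[of t] unfolding K_def by auto
  have at': "sgn (poly p a) = sgn (poly q b)" if "(a, b) \<in> K" for a b
    using that at B[of a b] E(1,2) unfolding K_def by auto
  have "\<exists>(a, b) \<in> K. a < t" "\<exists>(a, b) \<in> K. t < a"
    using E(3)[of t] unfolding K_def by auto
  from order_matching_gap[OF K ts' t' this] obtain l l' r r' where g: "(l, l') \<in> K" "(r, r') \<in> K" "l < t" "t < r" "l' < s" "s < r'"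
    "\<forall>z w. l < z \<longrightarrow> z < r \<longrightarrow> l' < w \<longrightarrow> w < r' \<longrightarrow> same_cut K z w"
    "\<forall>z. l < z \<longrightarrow> z < r \<longrightarrow> z \<notin> Domain K" "\<forall>w. l' < w \<longrightarrow> w < r' \<longrightarrow> w \<notin> Range K"
    by (elim exE conjE) (rule that)
  have "\<forall>z w. l < z \<longrightarrow> z < r \<longrightarrow> l' < w \<longrightarrow> w < r' \<longrightarrow> same_cut M z w"
    using g(7) unfolding K_def same_cut_Un by simp
  moreover have "\<forall>z. l < z \<longrightarrow> z < r \<longrightarrow> z \<notin> Domain M"
      "\<forall>w. l' < w \<longrightarrow> w < r' \<longrightarrow> w \<notin> Range M"
    using g(8,9) unfolding K_def by simp_all
  ultimately show ?thesis using g(3-6) at'[OF g(1)] at'[OF g(2)] by (intro exI conjI)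
qed

text \<open>
  The pairs by which a table is enlarged so that it also lists the roots of \<open>p\<close> and \<open>q\<close>. Roots are
  paired when they lie in corresponding cells; if the roots of the derivative are listed, a cell
  contains at most one root of \<open>p\<close>, by Rolle's theorem.
\<close>
definition common_roots :: "(real \<times> real) set \<Rightarrow> real poly \<Rightarrow> real poly \<Rightarrow> (real \<times> real) set" where
  "common_roots M p q = {(a, b). same_cut M a b \<and> poly p a = 0 \<and> poly q b = 0}"

lemma common_roots_converse: "common_roots (M\<inverse>) q p = (common_roots M p q)\<inverse>"
  unfolding common_roots_def using same_cut_converse by auto

lemma poly_Rolle:
  fixes p :: "real poly"
  assumes "poly p a = 0" "poly p c = 0" "a < c"
  shows "\<exists>z. a < z \<and> z < c \<and> poly (pderiv p) z = 0"
  using poly_MVT[OF assms(3), of p] assms by auto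

text \<open>
  Two roots of \<open>p\<close> are separated by a root of its derivative, which is in the table already; so the
  order of the roots of \<open>p\<close> is transported to the order of their partners, and conversely.
\<close>
lemma common_roots_order:
  assumes M: "order_matching M" and "p \<noteq> 0" "q \<noteq> 0"
    and dp: "\<forall>z. poly (pderiv p) z = 0 \<longrightarrow> z \<in> Domain M"
    and dq: "\<forall>w. poly (pderiv q) w = 0 \<longrightarrow> w \<in> Range M"
  shows "order_matching (M \<union> common_roots M p q)"
proof -
  let ?N = "common_roots M p q"
  have "?N \<subseteq> {a. poly p a = 0} \<times> {b. poly q b = 0}" unfolding common_roots_def by auto
  then have "finite ?N"
    using poly_roots_finite[OF \<open>p \<noteq> 0\<close>] poly_roots_finite[OF \<open>q \<noteq> 0\<close>] finite_subset
    by blast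
  moreover have less: "b < d" if ab: "(a, b) \<in> ?N" and cd: "(c, d) \<in> ?N" and "a < c" for a b c d
  proof -
    have "poly p a = 0" "poly p c = 0" using ab cd unfolding common_roots_def by auto
    from poly_Rolle[OF this \<open>a < c\<close>] obtain z where z: "a < z" "z < c" "poly (pderiv p) z = 0"
      by blast
    then obtain w where "(z, w) \<in> M" using dp by blast
    then have "b < w" "w < d"
      using z ab cd same_cutD[of M a b z w] same_cutD[of M c d z w]
      unfolding common_roots_def by auto
    then show ?thesis by simp
  qed
  moreover have less': "a < c" if ab: "(a, b) \<in> ?N" and cd: "(c, d) \<in> ?N" and "b < d" for a b c d
  proof -
    have "poly q b = 0" "poly q d = 0" using ab cd unfolding common_roots_def by auto
    from poly_Rolle[OF this \<open>b < d\<close>] obtain w where w: "b < w" "w < d" "poly (pderiv q) w = 0"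
      by blast
    then obtain z where "(z, w) \<in> M" using dq by blast
    then have "a < z" "z < c"
      using w ab cd same_cutD[of M a b z w] same_cutD[of M c d z w]
      unfolding common_roots_def by auto
    then show ?thesis by simp
  qed
  have NN: "sgn (a - c) = sgn (b - d)" if "(a, b) \<in> ?N" "(c, d) \<in> ?N" for a b c d
    using less[OF that] less'[OF that] less[OF that(2,1)] less'[OF that(2,1)]
    by (cases a c rule: linorder_cases; cases b d rule: linorder_cases) auto
  have NM: "sgn (a - c) = sgn (b - d)" if "(a, b) \<in> ?N" "(c, d) \<in> M" for a b c d
    using that unfolding common_roots_def same_cut_def by auto
  have MN: "sgn (c - a) = sgn (d - b)" if "(a, b) \<in> ?N" "(c, d) \<in> M" for a b c d
    using NM[OF that] by (auto simp: sgn_if split: if_splits)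
  have MM: "sgn (a - c) = sgn (b - d)" if "(a, b) \<in> M" "(c, d) \<in> M" for a b c d
    using M that unfolding order_matching_def same_cut_def by auto
  have "finite M" using M unfolding order_matching_def by simp
  with \<open>finite ?N\<close> show ?thesis
    unfolding order_matching_def same_cut_def using NN NM MN MM by blast
qed

text \<open>
  A root \<open>a\<close> of \<open>p\<close> that is not yet listed lies in a cell where the derivatives of \<open>p\<close> and \<open>q\<close> have
  the same constant sign, so \<open>q\<close> has a root in the partner cell.
\<close>
lemma common_roots_complete:
  assumes M: "order_matching M"
    and lead: "degree p = degree q" "sgn (lead_coeff p) = sgn (lead_coeff q)"
    and dp: "\<forall>z. poly (pderiv p) z = 0 \<longrightarrow> z \<in> Domain M"
    and match: "signs_match M (pderiv p) (pderiv q)"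
    and at: "\<forall>(a, b) \<in> M. sgn (poly p a) = sgn (poly q b)"
    and a: "poly p a = 0"
  shows "a \<in> Domain (M \<union> common_roots M p q)"
proof (cases "a \<in> Domain M")
  case False
  obtain s where s: "same_cut M a s" using same_cut_exists[OF M] .
  obtain l l' r r' where g: "l < a" "a < r" "l' < s" "s < r'"
    "sgn (poly p l) = sgn (poly q l')" "sgn (poly p r) = sgn (poly q r')"
    "\<forall>z w. l < z \<longrightarrow> z < r \<longrightarrow> l' < w \<longrightarrow> w < r' \<longrightarrow> same_cut M z w"
    using gap_with_equal_end_signs[OF M s False lead at] by (elim exE conjE) (rule that)
  define e where "e = sgn (poly (pderiv p) a)"
  have "e \<noteq> 0" using dp False unfolding e_def by (auto simp: sgn_zero_iff)
  have e': "e = sgn (poly (pderiv q) s)"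
    using match s unfolding signs_match_def e_def by auto
  have "\<exists>b. l' < b \<and> b < r' \<and> poly q b = 0"
  proof (rule monotone_gap_root[OF _ _ \<open>e \<noteq> 0\<close> _ g(5,6,1,2) a])
    show "sgn (poly (pderiv p) z) = e" if "l < z" "z < r" for z
      using match g(7)[rule_format, OF that g(3,4)] unfolding signs_match_def e' by auto
    show "sgn (poly (pderiv q) w) = e" if "l' < w" "w < r'" for w
      using match g(7)[rule_format, OF g(1,2) that] unfolding signs_match_def e_def by auto
    show "l' < r'" using g by simp
  qed
  then show ?thesis using g a unfolding common_roots_def by blast
qed auto

text \<open>
  The inductive step of the construction: between neighbouring listed points \<open>p\<close> and \<open>q\<close> are monotone in
  the same direction, because all roots of the derivatives are listed. The signs at the listed points
  and near infinity then locate the roots, and the roots the signs.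
\<close>
lemma extend_order_matching:
  assumes M: "order_matching M"
    and lead: "degree p = degree q" "sgn (lead_coeff p) = sgn (lead_coeff q)" and "degree p > 0"
    and dp: "\<forall>z. poly (pderiv p) z = 0 \<longrightarrow> z \<in> Domain M"
    and dq: "\<forall>w. poly (pderiv q) w = 0 \<longrightarrow> w \<in> Range M"
    and match: "signs_match M (pderiv p) (pderiv q)"
    and at: "\<forall>(a, b) \<in> M. sgn (poly p a) = sgn (poly q b)"
  defines "N \<equiv> M \<union> common_roots M p q"
  shows "order_matching N" and "signs_match N p q"
    and "\<And>a. poly p a = 0 \<Longrightarrow> a \<in> Domain N" and "\<And>b. poly q b = 0 \<Longrightarrow> b \<in> Range N"
proof -
  have "p \<noteq> 0" "q \<noteq> 0" using lead \<open>degree p > 0\<close> by auto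
  then show N: "order_matching N" unfolding N_def by (rule common_roots_order[OF M _ _ dp dq])
  show rootp: "a \<in> Domain N" if "poly p a = 0" for a
    unfolding N_def by (rule common_roots_complete[OF M lead dp match at that])
  show rootq: "b \<in> Range N" if "poly q b = 0" for b
  proof -
    have "b \<in> Domain (M\<inverse> \<union> common_roots (M\<inverse>) q p)"
      by (rule common_roots_complete[OF order_matching_converse[OF M] _ _ _ signs_match_converse[OF match] _ that])
        (use lead dq at in auto)
    then show ?thesis unfolding N_def common_roots_converse by auto
  qed
  have atN: "sgn (poly p a) = sgn (poly q b)" if "(a, b) \<in> N" for a b
    using that at unfolding N_def common_roots_def by auto
  show "signs_match N p q"
    unfolding signs_match_def
  proof (intro allI impI)
    fix t s assume ts: "same_cut N t s"
    then have tsM: "same_cut M t s" unfolding N_def same_cut_Un by blast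
    show "sgn (poly p t) = sgn (poly q s)"
    proof (cases "t \<in> Domain M")
      case True
      then obtain b where "(t, b) \<in> M" by blast
      then have "s = b" using same_cutD(3)[OF tsM] by blast
      then show ?thesis using at \<open>(t, b) \<in> M\<close> by blast
    next
      case False
      obtain l l' r r' where g: "l < t" "t < r" "l' < s" "s < r'"
        "sgn (poly p l) = sgn (poly q l')" "sgn (poly p r) = sgn (poly q r')"
        "\<And>z w. l < z \<Longrightarrow> z < r \<Longrightarrow> l' < w \<Longrightarrow> w < r' \<Longrightarrow> same_cut M z w"
        using gap_with_equal_end_signs[OF M tsM False lead at] by blast
      define e where "e = sgn (poly (pderiv p) t)"
      have "e \<noteq> 0" using dp False unfolding e_def by (auto simp: sgn_zero_iff)
      have e': "e = sgn (poly (pderiv q) s)"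
        using match tsM unfolding signs_match_def e_def by auto
      show ?thesis
      proof (rule monotone_gap_sign[OF _ _ \<open>e \<noteq> 0\<close> g(5,6,1-4)])
        show "sgn (poly (pderiv p) z) = e" if "l < z" "z < r" for z
          using match g(7)[rule_format, OF that g(3,4)] unfolding signs_match_def e' by auto
        show "sgn (poly (pderiv q) w) = e" if "l' < w" "w < r'" for w
          using match g(7)[rule_format, OF g(1,2) that] unfolding signs_match_def e_def by auto
        show "sgn (t - a) = sgn (s - b)"
          if "l < a" "a < r" "l' < b" "b < r'" "poly p a = 0" "poly q b = 0" for a b
        proof -
          have "(a, b) \<in> N" using g(7)[rule_format, OF that(1-4)] that(5,6) unfolding N_def common_roots_def by auto
          then show ?thesis using ts unfolding same_cut_def by auto
        qed
      qed
    qed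
  qed
qed

section \<open>Signs of univariate polynomials with polynomial parameters\<close>

text \<open>
  A polynomial in one variable whose coefficients are polynomial functions of a parameter. The
  number \<open>n\<close> only bounds the degree: for special parameters the coefficient of index \<open>n\<close> may vanish.
\<close>
definition param_poly :: "nat \<Rightarrow> ('a::euclidean_space \<Rightarrow> real poly) \<Rightarrow> bool" where
  "param_poly n P \<longleftrightarrow> (\<forall>x. degree (P x) \<le> n) \<and> (\<forall>i. real_polynomial_function (\<lambda>x. coeff (P x) i))"

definition poly_tail :: "nat \<Rightarrow> ('a \<Rightarrow> real poly) \<Rightarrow> 'a \<Rightarrow> real poly" where
  "poly_tail n P = (\<lambda>x. P x - monom (coeff (P x) n) n)"

text \<open>
  What is needed of a remainder of \<open>P\<close> modulo \<open>Q\<close>: it has the sign of \<open>P\<close> at every root of \<open>Q\<close>, as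
  long as the formal leading coefficient of \<open>Q\<close> does not vanish. Coefficients must stay polynomial
  in the parameter, so division is replaced by multiplication with squares.
\<close>
definition sign_remainder ::
  "('a \<Rightarrow> real poly) \<Rightarrow> nat \<Rightarrow> ('a \<Rightarrow> real poly) \<Rightarrow> ('a \<Rightarrow> real poly) \<Rightarrow> bool" where
  "sign_remainder P m Q R \<longleftrightarrow> (\<forall>x a. coeff (Q x) m \<noteq> 0 \<longrightarrow> poly (Q x) a = 0 \<longrightarrow>
     sgn (poly (R x) a) = sgn (poly (P x) a))"

lemma param_polyI:
  assumes "\<And>x i. i > n \<Longrightarrow> coeff (P x) i = 0"
    and "\<And>i. real_polynomial_function (\<lambda>x. coeff (P x) i)"
  shows "param_poly n P"
  using assms unfolding param_poly_def by (auto intro: degree_le)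

lemma param_poly_coeff: "param_poly n P \<Longrightarrow> real_polynomial_function (\<lambda>x. coeff (P x) i)"
  unfolding param_poly_def by blast

lemma param_poly_coeff_eq_0: "param_poly n P \<Longrightarrow> i > n \<Longrightarrow> coeff (P x) i = 0"
  unfolding param_poly_def by (meson coeff_eq_0 le_less_trans)

lemma param_poly_mono: "param_poly n P \<Longrightarrow> n \<le> m \<Longrightarrow> param_poly m P"
  unfolding param_poly_def by (meson order_trans)

lemma param_poly_pderiv:
  assumes "param_poly n P"
  shows "param_poly (n - 1) (\<lambda>x. pderiv (P x))"
proof (rule param_polyI)
  show "coeff (pderiv (P x)) i = 0" if "n - 1 < i" for x i
    using param_poly_coeff_eq_0[OF assms, of "Suc i"] that by (simp add: coeff_pderiv)
  show "real_polynomial_function (\<lambda>x. coeff (pderiv (P x)) i)" for i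
    unfolding coeff_pderiv
    by (intro real_polynomial_function.intros(3,4) param_poly_coeff[OF assms] real_polynomial_function.intros(2))
qed

lemma param_poly_tail:
  assumes "param_poly n P" "n > 0"
  shows "param_poly (n - 1) (poly_tail n P)"
proof (rule param_polyI)
  show "coeff (poly_tail n P x) i = 0" if "n - 1 < i" for x i
    using param_poly_coeff_eq_0[OF assms(1), of i] that assms(2) unfolding poly_tail_def
    by (cases "i = n") auto
  show "real_polynomial_function (\<lambda>x. coeff (poly_tail n P x) i)" for i
    using param_poly_coeff[OF assms(1)] unfolding poly_tail_def by (cases "i = n") auto
qed

text \<open>
  One step of pseudo-division. Multiplying by the square of the leading coefficient of \<open>Q\<close>, not by
  the coefficient itself, keeps the sign.
\<close>
lemma param_poly_reduction_step:
  assumes P: "param_poly n P" and Q: "param_poly m Q" and "0 < m" "m \<le> n"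
  defines "R \<equiv> \<lambda>x. smult ((coeff (Q x) m)\<^sup>2) (P x)
    - smult (coeff (Q x) m) (monom (coeff (P x) n) (n - m) * Q x)"
  shows "param_poly (n - 1) R" and "sign_remainder P m Q R"
proof -
  have R: "coeff (R x) i = (coeff (Q x) m)\<^sup>2 * coeff (P x) i
      - coeff (Q x) m * (if i < n - m then 0 else coeff (P x) n * coeff (Q x) (i - (n - m)))" for x i
    unfolding R_def by (simp add: coeff_monom_mult)
  show "param_poly (n - 1) R"
  proof (rule param_polyI)
    show "coeff (R x) i = 0" if "n - 1 < i" for x i
    proof (cases "i = n")
      case True
      then show ?thesis unfolding R using \<open>m \<le> n\<close> by (simp add: power2_eq_square)
    next
      case False
      then have "i > n" "i - (n - m) > m" using that \<open>0 < m\<close> \<open>m \<le> n\<close> by auto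
      then show ?thesis unfolding R using param_poly_coeff_eq_0[OF P] param_poly_coeff_eq_0[OF Q] by simp
    qed
    show "real_polynomial_function (\<lambda>x. coeff (R x) i)" for i
      unfolding R using param_poly_coeff[OF P] param_poly_coeff[OF Q]
      by (cases "i < n - m") (simp_all add: real_polynomial_function_diff real_polynomial_function_power
        real_polynomial_function.intros(2,4))
  qed
  have square: "sgn (c\<^sup>2 * d) = sgn d" if "c \<noteq> 0" for c d :: real
    using that sgn_pos[of "c\<^sup>2"] unfolding sgn_mult by simp
  show "sign_remainder P m Q R"
    unfolding sign_remainder_def R_def using square by simp
qed

lemma sign_remainder_exists:
  assumes Q: "param_poly m Q" and "0 < m" and "param_poly n P"
  shows "\<exists>R. param_poly (m - 1) R \<and> sign_remainder P m Q R"
  using assms(3)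
proof (induction n arbitrary: P rule: less_induct)
  case (less n)
  show ?case
  proof (cases "n < m")
    case True
    then have "param_poly (m - 1) P" using param_poly_mono[OF less.prems] by simp
    then show ?thesis unfolding sign_remainder_def by blast
  next
    case False
    then have "m \<le> n" by simp
    obtain P' where P': "param_poly (n - 1) P'" "sign_remainder P m Q P'"
      using param_poly_reduction_step[OF less.prems Q \<open>0 < m\<close> \<open>m \<le> n\<close>] by blast
    have "n - 1 < n" using \<open>0 < m\<close> \<open>m \<le> n\<close> by simp
    from less.IH[OF this P'(1)] obtain R where "param_poly (m - 1) R" "sign_remainder P' m Q R"
      by blast
    then show ?thesis using P'(2) unfolding sign_remainder_def by metis
  qed
qed

text \<open>
  All three operations (removing the formal leading term, differentiating, taking remainders) lower
  the index, which is why a finite closed family exists. The bound \<open>j\<close> on the index of the polynomial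
  to be differentiated or divided by allows to build it from the highest index downwards.
\<close>
definition closed_above :: "nat \<Rightarrow> (nat \<times> ('a::euclidean_space \<Rightarrow> real poly)) set \<Rightarrow> bool" where
  "closed_above j G \<longleftrightarrow> finite G \<and> (\<forall>n P. (n, P) \<in> G \<longrightarrow> param_poly n P) \<and>
    (\<forall>n P. (n, P) \<in> G \<longrightarrow> j \<le> n \<longrightarrow> (n - 1, poly_tail n P) \<in> G \<and> (n - 1, \<lambda>x. pderiv (P x)) \<in> G) \<and>
    (\<forall>n P m Q. (n, P) \<in> G \<longrightarrow> (m, Q) \<in> G \<longrightarrow> j \<le> m \<longrightarrow> m \<le> n \<longrightarrow>
       (\<exists>R. (m - 1, R) \<in> G \<and> sign_remainder P m Q R))"

text \<open>
  Everything that has to be added has index \<open>j - 1\<close>, so no new demand at index \<open>j\<close> or above arises.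
\<close>
lemma closed_above_step:
  assumes G: "closed_above (Suc j) G" and "0 < j"
  shows "\<exists>G'. G \<subseteq> G' \<and> closed_above j G'"
proof -
  note G = G[unfolded closed_above_def]
  have "\<forall>P Q. (\<exists>n. (n, P) \<in> G) \<longrightarrow> (j, Q) \<in> G \<longrightarrow> (\<exists>R. param_poly (j - 1) R \<and> sign_remainder P j Q R)"
    using sign_remainder_exists[OF _ \<open>0 < j\<close>] G by meson
  then obtain rem where rem: "\<And>n P Q. (n, P) \<in> G \<Longrightarrow> (j, Q) \<in> G \<Longrightarrow>
      param_poly (j - 1) (rem P Q) \<and> sign_remainder P j Q (rem P Q)"
    by metis
  define A where "A = (\<lambda>(n, P). (j - 1, poly_tail j P)) ` {z \<in> G. fst z = j}"
  define B where "B = (\<lambda>(n, P). (j - 1, \<lambda>x. pderiv (P x))) ` {z \<in> G. fst z = j}"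
  define C where "C = (\<lambda>((n, P), (m, Q)). (j - 1, rem P Q)) ` (G \<times> {z \<in> G. fst z = j})"
  have pp: "param_poly n P" if "(n, P) \<in> G" for n P using that G by blast
  have A: "n = j - 1 \<and> param_poly n P" if "(n, P) \<in> A" for n P
    using that param_poly_tail[OF pp \<open>0 < j\<close>] unfolding A_def by auto
  have B: "n = j - 1 \<and> param_poly n P" if "(n, P) \<in> B" for n P
    using that param_poly_pderiv[OF pp] unfolding B_def by auto
  have C: "n = j - 1 \<and> param_poly n P" if "(n, P) \<in> C" for n P
    using that rem unfolding C_def by auto
  let ?G = "G \<union> (A \<union> B \<union> C)"
  have new: "(n, P) \<in> G" if "(n, P) \<in> ?G" "j \<le> n" for n P
    using that A B C \<open>0 < j\<close> by fastforce
  have "finite ?G" using G unfolding A_def B_def C_def by auto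
  moreover have "param_poly n P" if "(n, P) \<in> ?G" for n P using that G A B C by blast
  moreover have "(n - 1, poly_tail n P) \<in> ?G \<and> (n - 1, \<lambda>x. pderiv (P x)) \<in> ?G"
    if "(n, P) \<in> ?G" "j \<le> n" for n P
  proof (cases "n = j")
    case True
    then show ?thesis using new[OF that] unfolding A_def B_def by force
  next
    case False
    then show ?thesis using new[OF that] G that(2) by auto
  qed
  moreover have "\<exists>R. (m - 1, R) \<in> ?G \<and> sign_remainder P m Q R"
    if nm: "(n, P) \<in> ?G" "(m, Q) \<in> ?G" "j \<le> m" "m \<le> n" for n m P Q
  proof -
    have PQ: "(n, P) \<in> G" "(m, Q) \<in> G"
      using new[OF nm(1) order_trans[OF nm(3,4)]] new[OF nm(2,3)] .
    show ?thesis
    proof (cases "m = j")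
      case True
      then have "(m - 1, rem P Q) \<in> C" using PQ unfolding C_def by force
      then show ?thesis using rem PQ True by blast
    next
      case False
      then show ?thesis using PQ nm(3,4) G by (metis UnI1 le_neq_implies_less Suc_leI)
    qed
  qed
  ultimately have "closed_above j ?G" unfolding closed_above_def by blast
  then show ?thesis by blast
qed

lemma closed_family_exists:
  assumes "finite F" and "\<And>n P. (n, P) \<in> F \<Longrightarrow> param_poly n P"
  shows "\<exists>G. F \<subseteq> G \<and> closed_above 1 G"
proof -
  define N where "N = Suc (Max (insert 0 (fst ` F)))"
  have N: "n < N" if "(n, P) \<in> F" for n P
    using that assms(1) unfolding N_def by (force simp: less_Suc_eq_le intro!: Max_ge)
  have "N \<ge> 1" unfolding N_def by simp
  then show ?thesis
  proof (induction rule: inc_induct)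
    case base
    have "closed_above N F" unfolding closed_above_def using assms N by (meson leD order.trans)
    then show ?case by blast
  next
    case (step j)
    then obtain G where "F \<subseteq> G" "closed_above (Suc j) G" by blast
    moreover have "0 < j" using step by simp
    ultimately show ?case using closed_above_step by (metis subset_trans)
  qed
qed

text \<open>
  The table lists the roots of all members of \<open>H\<close> that do not vanish identically, for the parameter
  \<open>x\<close> on the left and for \<open>y\<close> on the right, and it decides the signs of all members. Each entry must be
  a root of a member whose formal leading coefficient does not vanish: only such members allow
  remainders.
\<close>
definition family_match ::
  "(real \<times> real) set \<Rightarrow> (nat \<times> ('a \<Rightarrow> real poly)) set \<Rightarrow> 'a \<Rightarrow> 'a \<Rightarrow> bool" where
  "family_match M H x y \<longleftrightarrow> order_matching M \<and>
    (\<forall>(n, P) \<in> H. signs_match M (P x) (P y) \<and>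
       (P x \<noteq> 0 \<longrightarrow> (\<forall>z. poly (P x) z = 0 \<longrightarrow> z \<in> Domain M)) \<and>
       (P y \<noteq> 0 \<longrightarrow> (\<forall>w. poly (P y) w = 0 \<longrightarrow> w \<in> Range M))) \<and>
    (\<forall>(a, b) \<in> M. \<exists>(m, Q) \<in> H. 0 < m \<and> coeff (Q x) m \<noteq> 0 \<and> coeff (Q y) m \<noteq> 0 \<and>
       poly (Q x) a = 0 \<and> poly (Q y) b = 0)"

lemma family_matchD:
  assumes "family_match M H x y" and "(n, P) \<in> H"
  shows "signs_match M (P x) (P y)"
    and "P x \<noteq> 0 \<longrightarrow> (\<forall>z. poly (P x) z = 0 \<longrightarrow> z \<in> Domain M)"
    and "P y \<noteq> 0 \<longrightarrow> (\<forall>w. poly (P y) w = 0 \<longrightarrow> w \<in> Range M)"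
  using assms(1)[unfolded family_match_def, THEN conjunct2, THEN conjunct1, THEN bspec, OF assms(2)]
  by simp_all

lemma signs_match_Un: "signs_match M p q \<Longrightarrow> signs_match (M \<union> N) p q"
  unfolding signs_match_def same_cut_Un by blast

lemma family_match_insert_same:
  assumes "family_match M H x y" and "signs_match M (P x) (P y)"
    and "P x \<noteq> 0 \<Longrightarrow> \<forall>z. poly (P x) z = 0 \<longrightarrow> z \<in> Domain M"
    and "P y \<noteq> 0 \<Longrightarrow> \<forall>w. poly (P y) w = 0 \<longrightarrow> w \<in> Range M"
  shows "family_match M (insert (k, P) H) x y"
  using assms unfolding family_match_def by auto

text \<open>
  At a listed point, a root of some \<open>Q\<close> of index at most that of \<open>P\<close>, the sign of \<open>P\<close> is that of a
  remainder of \<open>P\<close> modulo \<open>Q\<close>; the remainder has smaller index and is already matched.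
\<close>
lemma family_match_signs_at_entries:
  assumes G: "closed_above 1 G" and H: "family_match M H x y"
    and low: "\<And>n Q. (n, Q) \<in> G \<Longrightarrow> n < k \<Longrightarrow> (n, Q) \<in> H"
    and sub: "\<And>n Q. (n, Q) \<in> H \<Longrightarrow> (n, Q) \<in> G \<and> n \<le> k"
    and P: "(k, P) \<in> G"
  shows "\<forall>(a, b) \<in> M. sgn (poly (P x) a) = sgn (poly (P y) b)"
proof (clarify)
  fix a b assume ab: "(a, b) \<in> M"
  then obtain m Q where Q: "(m, Q) \<in> H" "0 < m" "coeff (Q x) m \<noteq> 0" "coeff (Q y) m \<noteq> 0"
    "poly (Q x) a = 0" "poly (Q y) b = 0"
    using H unfolding family_match_def by fast
  have "(m, Q) \<in> G" "m \<le> k" "1 \<le> m" using sub Q by auto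
  then obtain R where R: "(m - 1, R) \<in> G" "sign_remainder P m Q R"
    using G P unfolding closed_above_def by blast
  then have "(m - 1, R) \<in> H" using low \<open>m \<le> k\<close> \<open>1 \<le> m\<close> by simp
  then have match: "signs_match M (R x) (R y)" by (rule family_matchD(1)[OF H])
  have cut: "same_cut M a b" using H ab unfolding family_match_def order_matching_def by blast
  have "sgn (poly (P x) a) = sgn (poly (R x) a)"
    using R(2) Q unfolding sign_remainder_def by simp
  also have "\<dots> = sgn (poly (R y) b)" using match cut unfolding signs_match_def by blast
  also have "\<dots> = sgn (poly (P y) b)"
    using R(2) Q unfolding sign_remainder_def by simp
  finally show "sgn (poly (P x) a) = sgn (poly (P y) b)" .
qed

text \<open>
  Members of index zero are constants of equal sign. For a larger index, if the formal leading
  coefficient vanishes at \<open>x\<close>, then it does so at \<open>y\<close>, and \<open>P\<close> agrees with a member of smaller index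
  at both. Otherwise the index of \<open>P\<close> is its degree for both parameters, and its derivative is matched
  already, so that \<open>extend_order_matching\<close> applies.
\<close>
lemma family_match_insert:
  assumes G: "closed_above 1 G" and H: "family_match M H x y"
    and low: "\<And>n Q. (n, Q) \<in> G \<Longrightarrow> n < k \<Longrightarrow> (n, Q) \<in> H"
    and sub: "\<And>n Q. (n, Q) \<in> H \<Longrightarrow> (n, Q) \<in> G \<and> n \<le> k"
    and P: "(k, P) \<in> G" and lead: "sgn (coeff (P x) k) = sgn (coeff (P y) k)"
  shows "\<exists>M'. family_match M' (insert (k, P) H) x y"
proof -
  have pp: "param_poly k P" using G P unfolding closed_above_def by blast
  have deg: "degree (P x) \<le> k" "degree (P y) \<le> k" using pp unfolding param_poly_def by auto
  have ops: "(k - 1, poly_tail k P) \<in> H" "(k - 1, \<lambda>x. pderiv (P x)) \<in> H" if "k > 0"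
    using G P low that unfolding closed_above_def by auto
  consider "coeff (P x) k = 0" "k = 0" | "coeff (P x) k = 0" "k > 0" |
    "coeff (P x) k \<noteq> 0" "k = 0" | "coeff (P x) k \<noteq> 0" "k > 0" by auto
  then show ?thesis
  proof cases
    case 1
    then have "coeff (P y) k = 0" using lead by (auto simp: sgn_zero_iff)
    then have "P x = 0" "P y = 0" using 1 deg by (metis le_zero_eq leading_coeff_0_iff)+
    then have "family_match M (insert (k, P) H) x y"
      by (intro family_match_insert_same[OF H]) (auto simp: signs_match_def)
    then show ?thesis by blast
  next
    case 2
    then have "coeff (P y) k = 0" using lead by (auto simp: sgn_zero_iff)
    then have T: "poly_tail k P x = P x" "poly_tail k P y = P y" using 2 unfolding poly_tail_def by auto
    have "family_match M (insert (k, P) H) x y"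
      by (rule family_match_insert_same[OF H])
        (use H ops(1)[OF \<open>k > 0\<close>] in \<open>unfold family_match_def, auto simp flip: T\<close>)
    then show ?thesis by blast
  next
    case 3
    obtain c d where cd: "P x = [:c:]" "P y = [:d:]"
      using deg 3 by (metis degree_eq_zeroE le_zero_eq)
    then have "c \<noteq> 0" "sgn c = sgn d" using 3 lead by auto
    then have "d \<noteq> 0" by (auto simp: sgn_zero_iff)
    have "family_match M (insert (k, P) H) x y"
      by (rule family_match_insert_same[OF H])
        (use cd \<open>c \<noteq> 0\<close> \<open>d \<noteq> 0\<close> \<open>sgn c = sgn d\<close> in \<open>auto simp: signs_match_def\<close>)
    then show ?thesis by blast
  next
    case 4
    then have y: "coeff (P y) k \<noteq> 0" using lead by (auto simp: sgn_zero_iff)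
    have dk: "degree (P x) = k" "degree (P y) = k" using 4 y deg le_degree by (auto intro: antisym)
    have "pderiv (P x) \<noteq> 0" "pderiv (P y) \<noteq> 0" using dk 4 by (auto simp: pderiv_eq_0_iff)
    then have der: "\<forall>z. poly (pderiv (P x)) z = 0 \<longrightarrow> z \<in> Domain M"
      "\<forall>w. poly (pderiv (P y)) w = 0 \<longrightarrow> w \<in> Range M"
      "signs_match M (pderiv (P x)) (pderiv (P y))"
      using family_matchD[OF H ops(2)[OF \<open>k > 0\<close>]] by simp_all
    have at: "\<forall>(a, b) \<in> M. sgn (poly (P x) a) = sgn (poly (P y) b)"
      by (rule family_match_signs_at_entries[OF G H low sub P])
    have M: "order_matching M" using H unfolding family_match_def by blast
    let ?N = "common_roots M (P x) (P y)"
    have lc: "degree (P x) = degree (P y)" "sgn (lead_coeff (P x)) = sgn (lead_coeff (P y))"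
      "degree (P x) > 0" using dk lead 4 by auto
    note ext = extend_order_matching[OF M lc der at]
    have "family_match (M \<union> ?N) H' x y" if H': "H' = insert (k, P) H" for H'
      unfolding family_match_def
    proof (intro conjI)
      show "order_matching (M \<union> ?N)" by (rule ext(1))
      show "\<forall>(n, Q) \<in> H'. signs_match (M \<union> ?N) (Q x) (Q y) \<and>
         (Q x \<noteq> 0 \<longrightarrow> (\<forall>z. poly (Q x) z = 0 \<longrightarrow> z \<in> Domain (M \<union> ?N))) \<and>
         (Q y \<noteq> 0 \<longrightarrow> (\<forall>w. poly (Q y) w = 0 \<longrightarrow> w \<in> Range (M \<union> ?N)))"
      proof (clarify, goal_cases)
        case (1 n Q)
        show ?case
        proof (cases "(n, Q) = (k, P)")
          case True
          then show ?thesis using ext by blast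
        next
          case False
          then have "(n, Q) \<in> H" using 1 H' by blast
          from family_matchD[OF H this] show ?thesis using signs_match_Un by blast
        qed
      qed
      have "\<exists>(m, Q) \<in> H'. 0 < m \<and> coeff (Q x) m \<noteq> 0 \<and> coeff (Q y) m \<noteq> 0 \<and>
         poly (Q x) a = 0 \<and> poly (Q y) b = 0" if "(a, b) \<in> ?N" for a b
        using that 4 y unfolding H' common_roots_def by auto
      moreover have "\<exists>(m, Q) \<in> H'. 0 < m \<and> coeff (Q x) m \<noteq> 0 \<and> coeff (Q y) m \<noteq> 0 \<and>
         poly (Q x) a = 0 \<and> poly (Q y) b = 0" if "(a, b) \<in> M" for a b
        using H that unfolding family_match_def H' by blast
      ultimately show "\<forall>(a, b) \<in> M \<union> ?N. \<exists>(m, Q) \<in> H'. 0 < m \<and> coeff (Q x) m \<noteq> 0 \<and>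
          coeff (Q y) m \<noteq> 0 \<and> poly (Q x) a = 0 \<and> poly (Q y) b = 0" by blast
    qed
    then show ?thesis by blast
  qed
qed

text \<open>
  Induction on the index, and within one index on the number of polynomials of that index.
\<close>
lemma family_match_exists:
  assumes G: "closed_above 1 G"
    and lead: "\<And>n P. (n, P) \<in> G \<Longrightarrow> sgn (coeff (P x) n) = sgn (coeff (P y) n)"
  shows "\<exists>M. family_match M G x y"
proof -
  have fin: "finite G" using G unfolding closed_above_def by blast
  have "\<exists>M. family_match M {z \<in> G. fst z < k} x y" for k
  proof (induction k)
    case 0
    have "family_match {} {z \<in> G. fst z < 0} x y"
      unfolding family_match_def order_matching_def by simp
    then show ?case by blast
  next
    case (Suc k)
    have "\<exists>M. family_match M ({z \<in> G. fst z < k} \<union> T) x y" if "T \<subseteq> {z \<in> G. fst z = k}" "finite T" for T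
      using that(2,1)
    proof (induction T rule: finite_induct)
      case empty
      then show ?case using Suc by simp
    next
      case (insert z T)
      obtain P where z: "z = (k, P)" "(k, P) \<in> G" using insert.prems by (cases z) auto
      obtain M where M: "family_match M ({z \<in> G. fst z < k} \<union> T) x y"
        using insert.IH insert.prems by blast
      have "\<exists>M'. family_match M' (insert (k, P) ({z \<in> G. fst z < k} \<union> T)) x y"
        by (rule family_match_insert[OF G M _ _ z(2) lead[OF z(2)]])
          (use insert.prems in force)+
      then show ?case using z(1) by simp
    qed
    from this[of "{z \<in> G. fst z = k}"] fin
    have "\<exists>M. family_match M ({z \<in> G. fst z < k} \<union> {z \<in> G. fst z = k}) x y" by simp
    moreover have "{z \<in> G. fst z < k} \<union> {z \<in> G. fst z = k} = {z \<in> G. fst z < Suc k}" by auto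
    ultimately show ?case by simp
  qed
  moreover have "{z \<in> G. fst z < Suc (Max (fst ` G))} = G"
    using fin by (auto simp: less_Suc_eq_le intro!: Max_ge)
  ultimately show ?thesis by metis
qed

text \<open>
  The heart of quantifier elimination: the sign vectors that a finite family attains along the line
  over a parameter depend only on the signs of finitely many polynomials in the parameter, namely
  of the formal leading coefficients of a closed family.
\<close>
lemma signs_determined_by_coefficients:
  assumes "finite F" and "\<And>n P. (n, P) \<in> F \<Longrightarrow> param_poly n P"
  shows "\<exists>Cs. finite Cs \<and> (\<forall>c \<in> Cs. real_polynomial_function c) \<and>
    (\<forall>x y. (\<forall>c \<in> Cs. sgn (c x) = sgn (c y)) \<longrightarrow>
       (\<forall>t. \<exists>s. \<forall>(n, P) \<in> F. sgn (poly (P x) t) = sgn (poly (P y) s)))"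
proof -
  obtain G where G: "F \<subseteq> G" "closed_above 1 G" using closed_family_exists[OF assms] by blast
  define Cs where "Cs = (\<lambda>(n, P) x. coeff (P x) n) ` G"
  have fin: "finite Cs" using G(2) unfolding Cs_def closed_above_def by blast
  have pp: "param_poly n P" if "(n, P) \<in> G" for n P
    using G(2) that unfolding closed_above_def by blast
  have rp: "\<forall>c \<in> Cs. real_polynomial_function c"
    unfolding Cs_def by (auto intro: param_poly_coeff[OF pp])
  \<comment> \<open>The point \<open>s\<close> is any partner of \<open>t\<close> for the table that matches the whole closed family.\<close>
  have det: "\<exists>s. \<forall>(n, P) \<in> F. sgn (poly (P x) t) = sgn (poly (P y) s)"
    if xy: "\<forall>c \<in> Cs. sgn (c x) = sgn (c y)" for x y t
  proof -
    have "sgn (coeff (P x) n) = sgn (coeff (P y) n)" if "(n, P) \<in> G" for n P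
      using xy that unfolding Cs_def by force
    then obtain M where M: "family_match M G x y" using family_match_exists[OF G(2)] by blast
    then have "order_matching M" unfolding family_match_def by blast
    then obtain s where s: "same_cut M t s" by (rule same_cut_exists)
    have "sgn (poly (P x) t) = sgn (poly (P y) s)" if "(n, P) \<in> F" for n P
    proof -
      have "signs_match M (P x) (P y)" using family_matchD(1)[OF M] that G(1) by blast
      then show ?thesis using s unfolding signs_match_def by blast
    qed
    then show ?thesis by blast
  qed
  show ?thesis using fin rp det by (intro exI[of _ Cs]) simp
qed

section \<open>Semi-algebraic sets and projection\<close>

text \<open>
  Membership in the set depends only on the signs of finitely many polynomials. This describes
  the semi-algebraic sets, and complements, preimages and projections are far easier to
  handle in this form than as unions of basic sets. By symmetry of the sign condition, the
  implication from \<open>x \<in> S\<close> to \<open>y \<in> S\<close> is an equivalence.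
\<close>
definition sign_invariant :: "('a::euclidean_space \<Rightarrow> real) set \<Rightarrow> 'a set \<Rightarrow> bool" where
  "sign_invariant Cs S \<longleftrightarrow> finite Cs \<and> (\<forall>c \<in> Cs. real_polynomial_function c) \<and>
    (\<forall>x y. (\<forall>c \<in> Cs. sgn (c x) = sgn (c y)) \<longrightarrow> x \<in> S \<longrightarrow> y \<in> S)"

lemma basic_semialgebraic_imp_sign_invariant:
  assumes "basic_semialgebraic A"
  shows "\<exists>Cs. sign_invariant Cs A"
proof -
  obtain P Q where PQ: "finite P" "finite Q" "\<forall>p \<in> P. real_polynomial_function p"
    "\<forall>q \<in> Q. real_polynomial_function q" and A: "A = {x. (\<forall>p \<in> P. p x = 0) \<and> (\<forall>q \<in> Q. q x > 0)}"
    using assms unfolding basic_semialgebraic_def by blast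
  have "sign_invariant (P \<union> Q) A"
    unfolding sign_invariant_def A using PQ by (auto simp: sgn_real_eq_iff)
  then show ?thesis by blast
qed

lemma semialgebraic_imp_sign_invariant:
  assumes "semialgebraic S"
  shows "\<exists>Cs. sign_invariant Cs S"
proof -
  obtain F where F: "finite F" "\<forall>A \<in> F. basic_semialgebraic A" "S = \<Union>F"
    using assms unfolding semialgebraic_def by blast
  have "\<forall>A \<in> F. \<exists>Cs. sign_invariant Cs A"
    using F(2) basic_semialgebraic_imp_sign_invariant by blast
  then obtain Cs where Cs: "\<forall>A \<in> F. sign_invariant (Cs A) A" using bchoice by meson
  have "sign_invariant (\<Union>(Cs ` F)) S"
    unfolding sign_invariant_def
  proof (intro conjI allI impI)
    show "finite (\<Union>(Cs ` F))" "\<forall>c \<in> \<Union>(Cs ` F). real_polynomial_function c"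
      using F(1) Cs unfolding sign_invariant_def by auto
    fix x y assume xy: "\<forall>c \<in> \<Union>(Cs ` F). sgn (c x) = sgn (c y)" and "x \<in> S"
    then obtain A where A: "A \<in> F" "x \<in> A" using F(3) by blast
    then have "sign_invariant (Cs A) A" "\<forall>c \<in> Cs A. sgn (c x) = sgn (c y)" using xy Cs by auto
    then have "y \<in> A" using A(2) unfolding sign_invariant_def by blast
    then show "y \<in> S" using A F(3) by blast
  qed
  then show ?thesis by blast
qed

lemma basic_semialgebraic_sign_class:
  fixes Cs :: "('a::euclidean_space \<Rightarrow> real) set"
  assumes "finite Cs" and "\<And>c. c \<in> Cs \<Longrightarrow> real_polynomial_function c"
  shows "basic_semialgebraic {y. \<forall>c \<in> Cs. sgn (c y) = sgn (c x)}"
proof -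
  let ?P = "{c \<in> Cs. c x = 0}"
  let ?Q = "{c \<in> Cs. c x > 0} \<union> (\<lambda>c y. - c y) ` {c \<in> Cs. c x < 0}"
  have "sgn (c y) = sgn (c x) \<longleftrightarrow>
      (c x = 0 \<longrightarrow> c y = 0) \<and> (c x > 0 \<longrightarrow> c y > 0) \<and> (c x < 0 \<longrightarrow> c y < 0)" for c :: "'a \<Rightarrow> real" and y
    by (auto simp: sgn_if)
  then have "{y. \<forall>c \<in> Cs. sgn (c y) = sgn (c x)} = {y. (\<forall>p \<in> ?P. p y = 0) \<and> (\<forall>q \<in> ?Q. q y > 0)}"
    by (auto simp: ball_Un)
  moreover have "\<forall>q \<in> ?Q. real_polynomial_function q" using assms(2) by auto
  ultimately show ?thesis
    unfolding basic_semialgebraic_def using assms by (intro exI[of _ ?P] exI[of _ ?Q]) auto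
qed

text \<open>
  Finitely many polynomials have finitely many sign patterns, and a set that respects them is the
  union of the classes it meets.
\<close>
lemma semialgebraicI_sign_invariant:
  assumes "sign_invariant Cs S"
  shows "semialgebraic S"
proof -
  have fin: "finite Cs" and poly: "\<And>c. c \<in> Cs \<Longrightarrow> real_polynomial_function c"
    and inv: "\<And>x y. \<forall>c \<in> Cs. sgn (c x) = sgn (c y) \<Longrightarrow> x \<in> S \<Longrightarrow> y \<in> S"
    using assms unfolding sign_invariant_def by simp_all
  define cls where "cls = (\<lambda>x. {y. \<forall>c \<in> Cs. sgn (c y) = sgn (c x)})"
  let ?f = "\<lambda>(A, B). {y. \<forall>c \<in> Cs. (c y > 0 \<longleftrightarrow> c \<in> A) \<and> (c y = 0 \<longleftrightarrow> c \<in> B)}"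
  have "cls x = ?f ({c \<in> Cs. c x > 0}, {c \<in> Cs. c x = 0})" for x
    unfolding cls_def sgn_real_eq_iff by auto
  then have "cls x \<in> ?f ` (Pow Cs \<times> Pow Cs)" for x
    by (rule image_eqI) auto
  then have "cls ` S \<subseteq> ?f ` (Pow Cs \<times> Pow Cs)" by (rule image_subsetI)
  then have "finite (cls ` S)" using fin by (meson finite_Pow_iff finite_SigmaI finite_imageI finite_subset)
  moreover have "\<forall>A \<in> cls ` S. basic_semialgebraic A"
    unfolding cls_def using basic_semialgebraic_sign_class[OF fin poly] by blast
  moreover have "S = \<Union>(cls ` S)"
  proof
    show "S \<subseteq> \<Union>(cls ` S)" unfolding cls_def by blast
    show "\<Union>(cls ` S) \<subseteq> S"
    proof
      fix y assume "y \<in> \<Union>(cls ` S)"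
      then obtain x where "x \<in> S" "\<forall>c \<in> Cs. sgn (c x) = sgn (c y)" unfolding cls_def by auto
      then show "y \<in> S" using inv by blast
    qed
  qed
  ultimately show ?thesis unfolding semialgebraic_def by blast
qed

lemma semialgebraic_Compl:
  assumes "semialgebraic S"
  shows "semialgebraic (- S)"
proof -
  obtain Cs where "sign_invariant Cs S" using semialgebraic_imp_sign_invariant[OF assms] by blast
  then have "sign_invariant Cs (- S)" unfolding sign_invariant_def by (metis ComplD ComplI)
  then show ?thesis by (rule semialgebraicI_sign_invariant)
qed

lemma semialgebraic_Un: "semialgebraic S \<Longrightarrow> semialgebraic T \<Longrightarrow> semialgebraic (S \<union> T)"
  unfolding semialgebraic_def by (metis Union_Un_distrib Un_iff finite_Un)

lemma semialgebraic_Int: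
  assumes "semialgebraic S" "semialgebraic T"
  shows "semialgebraic (S \<inter> T)"
proof -
  have "semialgebraic (- (- S \<union> - T))" by (intro semialgebraic_Compl semialgebraic_Un assms)
  then show ?thesis by simp
qed

lemma semialgebraic_vimage:
  assumes f: "polynomial_function f" and S: "semialgebraic S"
  shows "semialgebraic (f -` S)"
proof -
  obtain Cs where Cs: "sign_invariant Cs S" using semialgebraic_imp_sign_invariant[OF S] by blast
  have "sign_invariant ((\<lambda>c. c \<circ> f) ` Cs) (f -` S)"
    using Cs real_polynomial_function_compose[OF f] unfolding sign_invariant_def by simp
  then show ?thesis by (rule semialgebraicI_sign_invariant)
qed

lemma polynomial_function_as_param_poly:
  fixes p :: "'a::euclidean_space \<times> real \<Rightarrow> real"
  assumes "real_polynomial_function p"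
  shows "\<exists>n P. param_poly n P \<and> (\<forall>x t. poly (P x) t = p (x, t))"
  using assms
proof (induction p rule: real_polynomial_function.induct)
  case (linear f)
  interpret f: bounded_linear f by (rule linear)
  let ?P = "\<lambda>x. [:f (x, 0), f (0, 1):]"
  have "poly (?P x) t = f (x, t)" for x t
    using f.add[of "(x, 0)" "t *\<^sub>R (0, 1)"] f.scaleR[of t "(0, 1)"] by simp
  then have "\<forall>x t. poly (?P x) t = f (x, t)" by blast
  moreover have "param_poly 1 ?P"
  proof (rule param_polyI)
    have "bounded_linear (\<lambda>x::'a. f (x, 0))"
      by (rule f.bounded_linear_axioms[THEN bounded_linear_compose]) (auto intro: bounded_linear_intros)
    then show "real_polynomial_function (\<lambda>x. coeff (?P x) i)" for i
      by (cases i; cases "i - 1") (auto simp: coeff_pCons)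
  qed (auto simp: coeff_pCons split: nat.split)
  ultimately show ?case by blast
next
  case (const c)
  have "param_poly 0 (\<lambda>x::'a. [:c:])"
  proof (rule param_polyI)
    show "real_polynomial_function (\<lambda>x::'a. coeff [:c:] i)" for i by (rule real_polynomial_function.intros(2))
  qed (auto simp: coeff_pCons split: nat.split)
  then show ?case by (intro exI[of _ 0] exI[of _ "\<lambda>x. [:c:]"]) auto
next
  case (add f g)
  then obtain n P m Q where PQ: "param_poly n P" "\<forall>x t. poly (P x) t = f (x, t)"
    "param_poly m Q" "\<forall>x t. poly (Q x) t = g (x, t)" by blast
  have "param_poly (max n m) (\<lambda>x. P x + Q x)"
    by (rule param_polyI)
      (use param_poly_coeff_eq_0[OF PQ(1)] param_poly_coeff_eq_0[OF PQ(3)]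
        param_poly_coeff[OF PQ(1)] param_poly_coeff[OF PQ(3)] in auto)
  then show ?case using PQ(2,4) by (intro exI[of _ "max n m"] exI[of _ "\<lambda>x. P x + Q x"]) simp
next
  case (mult f g)
  then obtain n P m Q where PQ: "param_poly n P" "\<forall>x t. poly (P x) t = f (x, t)"
    "param_poly m Q" "\<forall>x t. poly (Q x) t = g (x, t)" by blast
  have "degree (P x * Q x) \<le> n + m" for x
    using degree_mult_le[of "P x" "Q x"] PQ(1,3) unfolding param_poly_def by (meson add_mono order_trans)
  moreover have "real_polynomial_function (\<lambda>x. coeff (P x * Q x) i)" for i
    unfolding coeff_mult
    by (intro real_polynomial_function_sum real_polynomial_function.intros(4)
        param_poly_coeff[OF PQ(1)] param_poly_coeff[OF PQ(3)]) simp
  ultimately have "param_poly (n + m) (\<lambda>x. P x * Q x)" unfolding param_poly_def by blast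
  then show ?case using PQ(2,4) by (intro exI[of _ "n + m"] exI[of _ "\<lambda>x. P x * Q x"]) simp
qed

text \<open>
  If \<open>x\<close> and \<open>y\<close> give the same signs to the coefficient polynomials, then each \<open>t\<close> over \<open>x\<close> has a
  counterpart \<open>s\<close> over \<open>y\<close> with the same signs of the polynomials that define \<open>S\<close>.
\<close>
theorem semialgebraic_projection_line:
  fixes S :: "('a::euclidean_space \<times> real) set"
  assumes "semialgebraic S"
  shows "semialgebraic {x. \<exists>t. (x, t) \<in> S}"
proof -
  obtain Cs where "sign_invariant Cs S" using semialgebraic_imp_sign_invariant[OF assms] by blast
  then have Cs: "finite Cs" "\<forall>c \<in> Cs. real_polynomial_function c"
    "\<forall>x y. (\<forall>c \<in> Cs. sgn (c x) = sgn (c y)) \<longrightarrow> x \<in> S \<longrightarrow> y \<in> S"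
    unfolding sign_invariant_def by simp_all
  have "\<forall>c \<in> Cs. \<exists>n P. param_poly n P \<and> (\<forall>x t. poly (P x) t = c (x, t))"
    using Cs(2) polynomial_function_as_param_poly by blast
  then obtain d P where P: "\<And>c. c \<in> Cs \<Longrightarrow> param_poly (d c) (P c)"
    "\<And>c x t. c \<in> Cs \<Longrightarrow> poly (P c x) t = c (x, t)"
    by metis
  have "\<exists>Ds. finite Ds \<and> (\<forall>c \<in> Ds. real_polynomial_function c) \<and>
    (\<forall>x y. (\<forall>c \<in> Ds. sgn (c x) = sgn (c y)) \<longrightarrow>
       (\<forall>t. \<exists>s. \<forall>(n, P) \<in> (\<lambda>c. (d c, P c)) ` Cs. sgn (poly (P x) t) = sgn (poly (P y) s)))"
    by (rule signs_determined_by_coefficients) (use Cs(1) P(1) in auto)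
  then obtain Ds where Ds: "finite Ds" "\<forall>c \<in> Ds. real_polynomial_function c"
    "\<forall>x y. (\<forall>c \<in> Ds. sgn (c x) = sgn (c y)) \<longrightarrow>
       (\<forall>t. \<exists>s. \<forall>(n, P) \<in> (\<lambda>c. (d c, P c)) ` Cs. sgn (poly (P x) t) = sgn (poly (P y) s))"
    by (elim exE conjE) (rule that)
  have "sign_invariant Ds {x. \<exists>t. (x, t) \<in> S}"
    unfolding sign_invariant_def
  proof (intro conjI allI impI Ds(1,2))
    fix x y assume xy: "\<forall>c \<in> Ds. sgn (c x) = sgn (c y)" and "x \<in> {x. \<exists>t. (x, t) \<in> S}"
    then obtain t where t: "(x, t) \<in> S" by blast
    obtain s where "\<forall>(n, P) \<in> (\<lambda>c. (d c, P c)) ` Cs. sgn (poly (P x) t) = sgn (poly (P y) s)"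
      using Ds(3)[rule_format, OF xy[rule_format]] by meson
    then have "\<forall>c \<in> Cs. sgn (c (x, t)) = sgn (c (y, s))" using P(2) by simp
    then show "y \<in> {x. \<exists>t. (x, t) \<in> S}" using Cs(3) t by blast
  qed
  then show ?thesis by (rule semialgebraicI_sign_invariant)
qed

text \<open>
  Projection along an arbitrary direction without leaving the space, so that the projections along
  several coordinates can be iterated in one type.
\<close>
lemma semialgebraic_sweep_line:
  fixes T :: "'a::euclidean_space set"
  assumes "semialgebraic T"
  shows "semialgebraic {x. \<exists>t::real. x + t *\<^sub>R v \<in> T}"
proof -
  have "polynomial_function (\<lambda>(x, t::real). x + t *\<^sub>R v)"
    by (rule polynomial_function_bounded_linear)
      (auto simp: case_prod_unfold intro!: bounded_linear_intros)
  from semialgebraic_projection_line[OF semialgebraic_vimage[OF this assms]]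
  show ?thesis by simp
qed

text \<open>
  The Tarski-Seidenberg theorem. The set is swept along the basis vectors of the second factor one
  after the other; afterwards it suffices to look at the points with second component zero.
\<close>
theorem semialgebraic_projection:
  fixes S :: "('a::euclidean_space \<times> 'b::euclidean_space) set"
  assumes "semialgebraic S"
  shows "semialgebraic {x. \<exists>y. (x, y) \<in> S}"
proof -
  have "semialgebraic {e. \<exists>v \<in> span B. e + (0, v) \<in> S}" if "finite B" for B :: "'b set"
    using that
  proof (induction B rule: finite_induct)
    case empty
    then show ?case using assms by (simp flip: zero_prod_def)
  next
    case (insert b B)
    have "(\<exists>v \<in> span (insert b B). e + (0, v) \<in> S) \<longleftrightarrow>
        (\<exists>t. \<exists>v \<in> span B. (e + t *\<^sub>R (0, b)) + (0, v) \<in> S)" for e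
    proof
      assume "\<exists>v \<in> span (insert b B). e + (0, v) \<in> S"
      then obtain v where "v \<in> span (insert b B)" and v: "e + (0, v) \<in> S" by blast
      then obtain t where "v - t *\<^sub>R b \<in> span B" using span_breakdown_eq[of v b B] by blast
      moreover have "(e + t *\<^sub>R (0, b)) + (0, v - t *\<^sub>R b) = e + (0, v)"
        by (cases e) simp
      ultimately show "\<exists>t. \<exists>v \<in> span B. (e + t *\<^sub>R (0, b)) + (0, v) \<in> S" using v by metis
    next
      assume "\<exists>t. \<exists>v \<in> span B. (e + t *\<^sub>R (0, b)) + (0, v) \<in> S"
      then obtain t v where v: "v \<in> span B" "(e + t *\<^sub>R (0, b)) + (0, v) \<in> S" by blast
      have "t *\<^sub>R b + v \<in> span (insert b B)" 
        using v(1) span_breakdown_eq[of "t *\<^sub>R b + v" b B] by (metis add_diff_cancel_left')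
      moreover have "(e + t *\<^sub>R (0, b)) + (0, v) = e + (0, t *\<^sub>R b + v)"
        by (cases e) simp
      ultimately show "\<exists>v \<in> span (insert b B). e + (0, v) \<in> S" using v(2) by metis
    qed
    then show ?case using semialgebraic_sweep_line[OF insert.IH, of "(0, b)"] by simp
  qed
  from this[of Basis] have "semialgebraic {e. \<exists>v. e + (0, v) \<in> S}" by simp
  moreover have "polynomial_function (\<lambda>x::'a. (x, 0::'b))"
    by (rule polynomial_function_bounded_linear) (auto intro!: bounded_linear_intros)
  ultimately have "semialgebraic ((\<lambda>x. (x, 0)) -` {e. \<exists>v. e + (0, v) \<in> S})"
    by (rule semialgebraic_vimage[rotated])
  then show ?thesis by simp
qed

lemma semialgebraic_nonneg:
  assumes "real_polynomial_function f"
  shows "semialgebraic {x. f x \<ge> 0}"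
proof (rule semialgebraicI_sign_invariant)
  show "sign_invariant {f} {x. f x \<ge> 0}"
    unfolding sign_invariant_def using assms by (auto simp: sgn_real_eq_iff)
qed

lemma semialgebraic_zero: "semialgebraic {0 :: 'a::euclidean_space}"
proof (rule semialgebraicI_sign_invariant)
  have "real_polynomial_function (\<lambda>z::'a. z \<bullet> b)" for b
    by (rule real_polynomial_function.intros(1)[OF bounded_linear_inner_left])
  moreover have "y = 0" if y: "\<forall>b \<in> Basis. sgn ((0::'a) \<bullet> b) = sgn (y \<bullet> b)" for y :: 'a
  proof (rule euclidean_eqI)
    fix b :: 'a assume "b \<in> Basis"
    with y have "sgn ((0::'a) \<bullet> b) = sgn (y \<bullet> b)" by blast
    then show "y \<bullet> b = 0 \<bullet> b" by (simp add: sgn_zero_iff)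
  qed
  ultimately show "sign_invariant ((\<lambda>b z. z \<bullet> b) ` Basis) {0 :: 'a}"
    unfolding sign_invariant_def by simp
qed

lemma semialgebraic_linear_vimage:
  "bounded_linear f \<Longrightarrow> semialgebraic S \<Longrightarrow> semialgebraic {x. f x \<in> S}"
  using semialgebraic_vimage[OF polynomial_function_bounded_linear] by (simp add: vimage_def)

text \<open>
  The values of \<open>\<nu>\<close> enter only through its graph, as existentially quantified real numbers.
\<close>
lemma semialgebraic_le:
  fixes \<nu> :: "'a::euclidean_space \<Rightarrow> real"
  assumes "semialgebraic_function \<nu>"
  shows "semialgebraic {p. \<nu> (fst p) \<le> \<nu> (snd p)}"
proof -
  let ?G = "{(x, t). t = \<nu> x}"
  let ?T = "{z :: ('a \<times> 'a) \<times> real \<times> real. (fst (fst z), fst (snd z)) \<in> ?G} \<inter>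
    {z. (snd (fst z), snd (snd z)) \<in> ?G} \<inter> {z. snd (snd z) - fst (snd z) \<ge> 0}"
  have G: "semialgebraic ?G" using assms unfolding semialgebraic_function_def .
  have "semialgebraic ?T"
    by (intro semialgebraic_Int semialgebraic_linear_vimage[OF _ G] semialgebraic_nonneg
        real_polynomial_function.intros(1) bounded_linear_intros)
  from semialgebraic_projection[OF this] show ?thesis by (simp add: case_prod_unfold)
qed

section \<open>Best approximations are a semi-algebraic notion\<close>

lemma best_approximation_iff:
  fixes \<nu> :: "'a::euclidean_space \<Rightarrow> real"
  assumes "is_norm \<nu>" "closed C"
  shows "best_approximation \<nu> C x y \<longleftrightarrow> y \<in> C \<and> (\<forall>w \<in> C. \<nu> (x - y) \<le> \<nu> (x - w))"
proof (cases "C = {}")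
  case False
  obtain u where u: "u \<in> C" "\<nu> (x - u) = norm_setdist \<nu> x C"
    "\<forall>z \<in> C. norm_setdist \<nu> x C \<le> \<nu> (x - z)"
    using norm_setdist_attained[OF assms False, of x] by blast
  then show ?thesis unfolding best_approximation_def by (metis antisym)
qed (simp add: best_approximation_def)

text \<open>
  The defining condition is a first-order formula over \<open>C\<close> and \<open>\<nu>\<close>, and each of its quantifiers is
  removed by a projection.
\<close>
theorem semialgebraic_nonunique_points:
  fixes \<nu> :: "'a::euclidean_space \<Rightarrow> real"
  assumes "is_norm \<nu>" "closed C" "semialgebraic C" "semialgebraic_function \<nu>"
  shows "semialgebraic (nonunique_points \<nu> C)"
proof -
  let ?le = "{p. \<nu> (fst p) \<le> \<nu> (snd p)}"
  define W where "W = {z :: ('a \<times> 'a) \<times> 'a. snd z \<in> C} \<inter>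
    - {z. (fst (fst z) - snd (fst z), fst (fst z) - snd z) \<in> ?le}"
  have le: "semialgebraic ?le" using semialgebraic_le[OF assms(4)] .
  have "semialgebraic W"
    unfolding W_def
    by (intro semialgebraic_Int semialgebraic_Compl semialgebraic_linear_vimage[OF _ le]
        semialgebraic_linear_vimage[OF _ assms(3)] bounded_linear_intros)
  note W = semialgebraic_projection[OF this]
  define B where "B = {p :: 'a \<times> 'a. snd p \<in> C} \<inter> - {p. \<exists>w. (p, w) \<in> W}"
  have B: "semialgebraic B"
    unfolding B_def
    by (intro semialgebraic_Int semialgebraic_Compl W
        semialgebraic_linear_vimage[OF _ assms(3)] bounded_linear_intros)
  have B_iff: "(x, y) \<in> B \<longleftrightarrow> best_approximation \<nu> C x y" for x y
    unfolding best_approximation_iff[OF assms(1,2)] B_def W_def by auto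
  define N where "N = {z :: 'a \<times> 'a \<times> 'a. (fst z, fst (snd z)) \<in> B} \<inter>
    {z. (fst z, snd (snd z)) \<in> B} \<inter> - {z. fst (snd z) - snd (snd z) \<in> {0}}"
  have "semialgebraic N"
    unfolding N_def
    by (intro semialgebraic_Int semialgebraic_Compl semialgebraic_linear_vimage[OF _ B]
        semialgebraic_linear_vimage[OF _ semialgebraic_zero] bounded_linear_intros)
  note N = semialgebraic_projection[OF this]
  have "nonunique_points \<nu> C = - C \<inter> {x. \<exists>yz. (x, yz) \<in> N}"
    unfolding nonunique_points_def N_def using B_iff by auto
  then show ?thesis using N assms(3) by (simp add: semialgebraic_Int semialgebraic_Compl)
qed

section \<open>A smooth dual norm makes the norm strictly convex\<close>

lemma derivative_le_of_increment_le:
  fixes f :: "'a::real_normed_vector \<Rightarrow> real"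
  assumes f': "(f has_derivative f') (at w)"
    and le: "\<And>t. 0 < t \<Longrightarrow> t < 1 \<Longrightarrow> f (w + t *\<^sub>R h) \<le> f w + t * c"
  shows "f' h \<le> c"
proof -
  interpret f': bounded_linear f' by (rule has_derivative_bounded_linear[OF f'])
  have "((\<lambda>t. f (w + t *\<^sub>R h)) has_derivative (\<lambda>t. f' (t *\<^sub>R h))) (at 0)"
    by (rule has_derivative_compose[of "\<lambda>t. w + t *\<^sub>R h" "\<lambda>t. t *\<^sub>R h" 0 UNIV f f', simplified])
      (use f' in \<open>auto intro!: derivative_eq_intros\<close>)
  moreover have "(\<lambda>t. f' (t *\<^sub>R h)) = (*) (f' h)" by (simp add: fun_eq_iff f'.scaleR)
  ultimately have "((\<lambda>t. f (w + t *\<^sub>R h)) has_real_derivative f' h) (at 0)"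
    unfolding has_field_derivative_def by simp
  then have "((\<lambda>t. (f (w + t *\<^sub>R h) - f w) / t) \<longlongrightarrow> f' h) (at 0)"
    by (simp add: has_field_derivative_iff)
  then have lim: "((\<lambda>t. (f (w + t *\<^sub>R h) - f w) / t) \<longlongrightarrow> f' h) (at_right 0)"
    by (rule filterlim_mono[OF _ order_refl at_le]) simp
  have "eventually (\<lambda>t. (f (w + t *\<^sub>R h) - f w) / t \<le> c) (at_right 0)"
    using eventually_at_right_real[OF zero_less_one]
  proof eventually_elim
    case (elim t)
    then show ?case using le[of t] by (simp add: field_simps)
  qed
  then show ?thesis by (rule tendsto_upperbound[OF lim]) simp
qed

text \<open>
  The derivative of the norm at \<open>w\<close>. The triangle inequality bounds it by the norm, and along the ray
  through \<open>w\<close> the norm is linear, which gives the equality.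
\<close>
lemma norming_functional:
  fixes \<nu> :: "'a::euclidean_space \<Rightarrow> real"
  assumes \<nu>: "is_norm \<nu>" and "\<nu> differentiable (at w)"
  obtains l where "\<And>h. h \<bullet> l \<le> \<nu> h" "w \<bullet> l = \<nu> w"
proof -
  have nn: "\<nu> (c *\<^sub>R x) = \<bar>c\<bar> * \<nu> x" "\<nu> (x + y) \<le> \<nu> x + \<nu> y" for c x y
    using \<nu> unfolding is_norm_def by auto
  obtain f' where f': "(\<nu> has_derivative f') (at w)" using assms(2) unfolding differentiable_def by blast
  interpret f': bounded_linear f' by (rule has_derivative_bounded_linear[OF f'])
  have le: "f' h \<le> \<nu> h" for h
  proof (rule derivative_le_of_increment_le[OF f'])
    fix t :: real assume "0 < t"
    then show "\<nu> (w + t *\<^sub>R h) \<le> \<nu> w + t * \<nu> h" using nn(2)[of w "t *\<^sub>R h"] by (simp add: nn(1))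
  qed
  have "f' (- w) \<le> - \<nu> w"
  proof (rule derivative_le_of_increment_le[OF f'])
    fix t :: real assume t: "0 < t" "t < 1"
    have w: "w + t *\<^sub>R - w = (1 - t) *\<^sub>R w" by (simp add: algebra_simps)
    show "\<nu> (w + t *\<^sub>R - w) \<le> \<nu> w + t * - \<nu> w"
      unfolding w nn(1) using t by (simp add: left_diff_distrib)
  qed
  then have "\<nu> w \<le> f' w" by (simp add: f'.neg)
  define l where "l = (\<Sum>b\<in>Basis. f' b *\<^sub>R b)"
  have "h \<bullet> l = f' h" for h
  proof -
    have "f' h = f' (\<Sum>b\<in>Basis. (h \<bullet> b) *\<^sub>R b)" by (simp add: euclidean_representation)
    also have "\<dots> = h \<bullet> l" unfolding l_def by (simp add: f'.sum f'.scaleR inner_sum_right mult.commute)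
    finally show ?thesis by simp
  qed
  then show thesis using that[of l] le \<open>\<nu> w \<le> f' w\<close> by (simp add: antisym)
qed

text \<open>
  Every unit vector \<open>u\<close> with \<open>u \<bullet> l = 1\<close> supports the dual norm from below at \<open>l\<close> by a linear
  function, so differentiability identifies \<open>u\<close> with the derivative of the dual norm at \<open>l\<close>.
\<close>
lemma dual_norm_smooth_unique_norming:
  fixes \<nu> :: "'a::euclidean_space \<Rightarrow> real"
  assumes \<nu>: "is_norm \<nu>" and diff: "dual_norm \<nu> differentiable (at l)" and l: "dual_norm \<nu> l = 1"
    and u: "\<nu> u = 1" "u \<bullet> l = 1" and v: "\<nu> v = 1" "v \<bullet> l = 1"
  shows "u = v"
proof -
  obtain g where g: "(dual_norm \<nu> has_derivative g) (at l)"
    using diff unfolding differentiable_def by blast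
  interpret g: bounded_linear g by (rule has_derivative_bounded_linear[OF g])
  have *: "g h = u \<bullet> h" if u: "\<nu> u = 1" "u \<bullet> l = 1" for u h
  proof -
    have ge: "u \<bullet> h \<le> g h" for h
    proof -
      have "- g h \<le> - (u \<bullet> h)"
      proof (rule derivative_le_of_increment_le[OF has_derivative_minus[OF g]])
        fix t :: real
        have "u \<bullet> (l + t *\<^sub>R h) \<le> dual_norm \<nu> (l + t *\<^sub>R h)"
          using dual_norm_attained[OF \<nu>, of "l + t *\<^sub>R h"] u(1) by blast
        then show "- dual_norm \<nu> (l + t *\<^sub>R h) \<le> - dual_norm \<nu> l + t * - (u \<bullet> h)"
          using u(2) l by (simp add: inner_right_distrib)
      qed
      then show ?thesis by simp
    qed
    from ge[of h] ge[of "- h"] show ?thesis by (simp add: g.neg)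
  qed
  have "(u - v) \<bullet> h = 0" for h using *[OF u, of h] *[OF v, of h] by (simp add: inner_diff_left)
  from this[of "u - v"] show ?thesis by simp
qed

text \<open>
  A functional that norms \<open>a + b\<close> must norm both \<open>a\<close> and \<open>b\<close> when the triangle inequality is an
  equality, and only one unit vector is normed by it.
\<close>
theorem smooth_dual_imp_strictly_convex:
  fixes \<nu> :: "'a::euclidean_space \<Rightarrow> real"
  assumes \<nu>: "is_norm \<nu>"
    and diff: "\<nu> differentiable_on UNIV - {0}" "dual_norm \<nu> differentiable_on UNIV - {0}"
    and ab: "a \<noteq> 0" "b \<noteq> 0" "\<nu> (a + b) = \<nu> a + \<nu> b"
  shows "(1 / \<nu> a) *\<^sub>R a = (1 / \<nu> b) *\<^sub>R b"
proof -
  have scale: "\<nu> (c *\<^sub>R x) = \<bar>c\<bar> * \<nu> x" and pos: "x \<noteq> 0 \<Longrightarrow> \<nu> x > 0" for c x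
    using \<nu> unfolding is_norm_def by (auto simp: less_le)
  have at: "f differentiable (at x)" if "f differentiable_on UNIV - {0}" "x \<noteq> 0" for f :: "'a \<Rightarrow> real" and x
    using that differentiable_on_eq_differentiable_at[of "UNIV - {0 :: 'a}" f] by (simp add: open_delete)
  have "\<nu> 0 = 0" using \<nu> unfolding is_norm_def by blast
  then have "a + b \<noteq> 0" using ab pos[of a] pos[of b] by force
  then obtain l where l: "\<And>h. h \<bullet> l \<le> \<nu> h" "(a + b) \<bullet> l = \<nu> (a + b)"
    using norming_functional[OF \<nu> at[OF diff(1)]] by blast
  then have al: "a \<bullet> l = \<nu> a" "b \<bullet> l = \<nu> b"
    using l(1)[of a] l(1)[of b] ab(3) unfolding inner_left_distrib by linarith+
  define u where "u = (1 / \<nu> a) *\<^sub>R a"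
  define v where "v = (1 / \<nu> b) *\<^sub>R b"
  have u: "\<nu> u = 1" "u \<bullet> l = 1" and v: "\<nu> v = 1" "v \<bullet> l = 1"
    using pos[of a] pos[of b] ab al by (auto simp: u_def v_def scale)
  have l1: "dual_norm \<nu> l = 1"
    using dual_norm_attained[OF \<nu>, of l] l(1) u by (metis antisym)
  have "l \<noteq> 0" using u(2) by auto
  from dual_norm_smooth_unique_norming[OF \<nu> at[OF diff(2) this] l1 u v]
  show ?thesis unfolding u_def v_def .
qed

section \<open>Points with a unique best approximation are dense outside the set\<close>

text \<open>
  Moving from \<open>x\<close> towards a best approximation \<open>y\<close> decreases the distance to \<open>C\<close> at full speed. A best
  approximation \<open>z\<close> to the new point therefore realizes equality in the triangle inequality for
  \<open>x\<close>, the new point and \<open>z\<close>; strict convexity puts \<open>z\<close> on the same ray as \<open>y\<close>, at the same distance.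
\<close>
lemma unique_best_approximation_towards_projection:
  fixes \<nu> :: "'a::euclidean_space \<Rightarrow> real"
  assumes \<nu>: "is_norm \<nu>" and "closed C"
    and strict: "\<And>a b. a \<noteq> 0 \<Longrightarrow> b \<noteq> 0 \<Longrightarrow> \<nu> (a + b) = \<nu> a + \<nu> b \<Longrightarrow>
                   (1 / \<nu> a) *\<^sub>R a = (1 / \<nu> b) *\<^sub>R b"
    and "x \<notin> C" and y: "best_approximation \<nu> C x y" and t: "0 < t" "t < 1"
    and z: "best_approximation \<nu> C (x + t *\<^sub>R (y - x)) z"
  shows "z = y"
proof -
  have scale: "\<nu> (c *\<^sub>R x) = \<bar>c\<bar> * \<nu> x" and pos: "x \<noteq> 0 \<Longrightarrow> \<nu> x > 0"
    and tri: "\<nu> (x + w) \<le> \<nu> x + \<nu> w" for c x w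
    using \<nu> unfolding is_norm_def by (auto simp: less_le)
  note y = y[unfolded best_approximation_iff[OF \<nu> \<open>closed C\<close>]]
  note z = z[unfolded best_approximation_iff[OF \<nu> \<open>closed C\<close>]]
  define d where "d = \<nu> (x - y)"
  have xy: "x - y \<noteq> 0" using y \<open>x \<notin> C\<close> by auto
  then have "d > 0" unfolding d_def by (rule pos)
  define a where "a = t *\<^sub>R (x - y)"
  define b where "b = x + t *\<^sub>R (y - x) - z"
  have ab: "a + b = x - z" unfolding a_def b_def by (simp add: algebra_simps)
  have \<nu>a: "\<nu> a = t * d" unfolding a_def d_def using t by (simp add: scale)
  have "x + t *\<^sub>R (y - x) - y = (1 - t) *\<^sub>R (x - y)" by (simp add: algebra_simps)
  then have "\<nu> (x + t *\<^sub>R (y - x) - y) = (1 - t) * d" unfolding d_def using t by (simp add: scale)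
  then have "\<nu> b \<le> (1 - t) * d" using z y unfolding b_def by metis
  moreover have "d \<le> \<nu> (a + b)" using y z unfolding ab d_def by blast
  ultimately have eq: "\<nu> (a + b) = \<nu> a + \<nu> b" "\<nu> b = (1 - t) * d"
    using tri[of a b] \<nu>a by (auto simp: algebra_simps)
  have "\<nu> b > 0" using eq(2) t \<open>d > 0\<close> by simp
  moreover have "\<nu> 0 = 0" using \<nu> unfolding is_norm_def by blast
  ultimately have "b \<noteq> 0" by auto
  have "a \<noteq> 0" unfolding a_def using t xy by simp
  have "(1 / \<nu> a) *\<^sub>R a = (1 / \<nu> b) *\<^sub>R b" by (rule strict[OF \<open>a \<noteq> 0\<close> \<open>b \<noteq> 0\<close> eq(1)])
  moreover have "(1 / \<nu> a) *\<^sub>R a = (1 / d) *\<^sub>R (x - y)"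
    unfolding \<nu>a using t by (simp add: a_def)
  ultimately have "(1 / d) *\<^sub>R (x - y) = (1 / ((1 - t) * d)) *\<^sub>R b" unfolding eq(2) by simp
  then have "((1 - t) * d) *\<^sub>R ((1 / d) *\<^sub>R (x - y)) = ((1 - t) * d) *\<^sub>R ((1 / ((1 - t) * d)) *\<^sub>R b)"
    by simp
  then have "(1 - t) *\<^sub>R (x - y) = b" using t \<open>d > 0\<close> by simp
  then show ?thesis unfolding b_def by (simp add: algebra_simps)
qed

theorem nonunique_points_no_open_subset:
  fixes \<nu> :: "'a::euclidean_space \<Rightarrow> real"
  assumes \<nu>: "is_norm \<nu>" and "closed C"
    and diff: "\<nu> differentiable_on UNIV - {0}" "dual_norm \<nu> differentiable_on UNIV - {0}"
    and U: "open U" "U \<noteq> {}"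
  shows "\<not> U \<subseteq> nonunique_points \<nu> C"
proof
  assume sub: "U \<subseteq> nonunique_points \<nu> C"
  obtain x where x: "x \<in> U" using U(2) by blast
  then obtain y where y: "x \<notin> C" "best_approximation \<nu> C x y"
    using sub unfolding nonunique_points_def by blast
  have "((\<lambda>t. x + t *\<^sub>R (y - x)) \<longlongrightarrow> x + 0 *\<^sub>R (y - x)) (at_right 0)"
    by (intro tendsto_intros)
  then have "eventually (\<lambda>t. x + t *\<^sub>R (y - x) \<in> U) (at_right 0)"
    using topological_tendstoD[OF _ U(1)] x by fastforce
  then have "eventually (\<lambda>t. x + t *\<^sub>R (y - x) \<in> U \<and> t \<in> {0<..<1}) (at_right (0::real))"
    using eventually_at_right_real[of 0 "1::real"] by (simp add: eventually_conj)
  then obtain t where t: "x + t *\<^sub>R (y - x) \<in> U" "0 < t" "t < 1"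
    using eventually_happens'[OF trivial_limit_at_right_real] by fastforce
  then obtain z1 z2 where z: "best_approximation \<nu> C (x + t *\<^sub>R (y - x)) z1"
    "best_approximation \<nu> C (x + t *\<^sub>R (y - x)) z2" "z1 \<noteq> z2"
    using sub unfolding nonunique_points_def by blast
  have "z = y" if "best_approximation \<nu> C (x + t *\<^sub>R (y - x)) z" for z
    by (rule unique_best_approximation_towards_projection[OF \<nu> \<open>closed C\<close> _ y t(2,3) that])
      (rule smooth_dual_imp_strictly_convex[OF \<nu> diff])
  then show False using z by blast
qed

section \<open>Semi-algebraic sets with empty interior\<close>

text \<open>
  On the line through a point where \<open>p\<close> does not vanish and one where \<open>q\<close> does not, both are nonzero
  polynomials in one variable, and these form an integral domain.
\<close>
lemma nonzero_polynomial_mult: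
  fixes p q :: "'a::euclidean_space \<Rightarrow> real"
  assumes p: "real_polynomial_function p" "p a \<noteq> 0" and q: "real_polynomial_function q" "q b \<noteq> 0"
  shows "\<exists>x. p x * q x \<noteq> 0"
proof -
  have line: "\<exists>P. \<forall>t. poly P t = f (a + t *\<^sub>R (b - a))" if "real_polynomial_function f" for f :: "'a \<Rightarrow> real"
  proof -
    have "polynomial_function (\<lambda>z::'a \<times> real. a + snd z *\<^sub>R (b - a))"
      by (intro polynomial_function_add polynomial_function_const polynomial_function_bounded_linear
          bounded_linear_intros)
    from real_polynomial_function_compose[OF this that] 
    show ?thesis using polynomial_function_as_param_poly by fastforce
  qed
  obtain P Q where PQ: "\<And>t. poly P t = p (a + t *\<^sub>R (b - a))" "\<And>t. poly Q t = q (a + t *\<^sub>R (b - a))"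
    using line[OF p(1)] line[OF q(1)] by blast
  have "P \<noteq> 0" "Q \<noteq> 0" using PQ(1)[of 0] PQ(2)[of 1] p(2) q(2) by auto
  then have "P * Q \<noteq> 0" by simp
  then obtain t where "poly (P * Q) t \<noteq> 0" using poly_all_0_iff_0 by blast
  then show ?thesis using PQ by auto
qed

lemma nonzero_polynomial_prod:
  fixes p :: "'i \<Rightarrow> 'a::euclidean_space \<Rightarrow> real"
  assumes "finite I" and "\<And>i. i \<in> I \<Longrightarrow> real_polynomial_function (p i) \<and> (\<exists>x. p i x \<noteq> 0)"
  shows "\<exists>x. (\<Prod>i\<in>I. p i x) \<noteq> 0"
  using assms
proof (induction I rule: finite_induct)
  case (insert i I)
  then obtain x y where xy: "p i x \<noteq> 0" "(\<Prod>j\<in>I. p j y) \<noteq> 0" by blast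
  have "real_polynomial_function (\<lambda>x. \<Prod>j\<in>I. p j x)"
    using insert by (intro real_polynomial_function_prod) auto
  moreover have "real_polynomial_function (p i)" using insert by blast
  ultimately have "\<exists>x. p i x * (\<Prod>j\<in>I. p j x) \<noteq> 0"
    using nonzero_polynomial_mult[of "p i" x "\<lambda>x. \<Prod>j\<in>I. p j x" y] xy by blast
  then show ?case using insert by simp
qed simp

text \<open>
  If all the equations were trivial, the strict inequalities would define an open set.
\<close>
lemma basic_semialgebraic_thin:
  assumes "basic_semialgebraic A" and thin: "\<And>U. open U \<Longrightarrow> U \<noteq> {} \<Longrightarrow> \<not> U \<subseteq> A"
  shows "\<exists>p. real_polynomial_function p \<and> (\<exists>x. p x \<noteq> 0) \<and> (\<forall>x \<in> A. p x = 0)"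
proof -
  obtain P Q where PQ: "finite P" "finite Q" "\<forall>p \<in> P. real_polynomial_function p"
    "\<forall>q \<in> Q. real_polynomial_function q" and A: "A = {x. (\<forall>p \<in> P. p x = 0) \<and> (\<forall>q \<in> Q. q x > 0)}"
    using assms unfolding basic_semialgebraic_def by blast
  show ?thesis
  proof (cases "\<exists>p \<in> P. \<exists>x. p x \<noteq> 0")
    case True
    then show ?thesis using PQ A by blast
  next
    case False
    then have "A = (\<Inter>q \<in> Q. {x. 0 < q x})" unfolding A by auto
    moreover have "open {x. 0 < q x}" if "q \<in> Q" for q
      using that PQ(4) by (intro open_Collect_less continuous_on_const continuous_on_polymonial_function)
        (simp add: real_polynomial_function_eq)
    ultimately have "open A" using PQ(2) by auto
    then have "A = {}" using thin by blast
    \<comment> \<open>On the empty piece any equation holds; the constant \<open>1\<close> is nonzero.\<close>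
    then show ?thesis by (intro exI[of _ "\<lambda>x. 1"]) auto
  qed
qed

text \<open>
  The product of one nonzero equation for each basic piece vanishes on the whole set.
\<close>
theorem thin_semialgebraic_subset_hypersurface:
  fixes S :: "'a::euclidean_space set"
  assumes "semialgebraic S" and thin: "\<And>U. open U \<Longrightarrow> U \<noteq> {} \<Longrightarrow> \<not> U \<subseteq> S"
  shows "\<exists>H. hypersurface H \<and> S \<subseteq> H"
proof -
  obtain F where F: "finite F" "\<forall>A \<in> F. basic_semialgebraic A" "S = \<Union>F"
    using assms(1) unfolding semialgebraic_def by blast
  have "\<forall>A \<in> F. \<exists>p. real_polynomial_function p \<and> (\<exists>x. p x \<noteq> 0) \<and> (\<forall>x \<in> A. p x = 0)"
  proof
    fix A assume "A \<in> F"
    then show "\<exists>p. real_polynomial_function p \<and> (\<exists>x. p x \<noteq> 0) \<and> (\<forall>x \<in> A. p x = 0)"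
      using thin F by (intro basic_semialgebraic_thin) blast+
  qed
  then obtain p where p: "\<forall>A \<in> F. real_polynomial_function (p A) \<and> (\<exists>x. p A x \<noteq> 0) \<and> (\<forall>x \<in> A. p A x = 0)"
    by (rule bchoice[THEN exE])
  obtain b :: 'a where b: "b \<in> Basis" using nonempty_Basis by blast
  define q where "q = (\<lambda>x. \<Prod>A\<in>F. p A x)"
  \<comment> \<open>The linear factor excludes the case that the product is a nonzero constant (for an empty set).\<close>
  define r where "r = (\<lambda>x. (x \<bullet> b) * q x)"
  have q: "real_polynomial_function q"
    unfolding q_def using F(1) p by (intro real_polynomial_function_prod) auto
  obtain x where "q x \<noteq> 0" unfolding q_def using nonzero_polynomial_prod[OF F(1), of p] p by blast
  moreover have inner: "real_polynomial_function (\<lambda>x. x \<bullet> b)"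
    by (intro real_polynomial_function.intros(1) bounded_linear_inner_left)
  moreover have "b \<bullet> b \<noteq> 0" using b by simp
  ultimately obtain z where z: "r z \<noteq> 0" unfolding r_def using nonzero_polynomial_mult q by metis
  have "r 0 = 0" unfolding r_def by simp
  then have "\<not> r constant_on UNIV" using z unfolding constant_on_def by (metis UNIV_I)
  moreover have "real_polynomial_function r"
    unfolding r_def by (rule real_polynomial_function.intros(4)[OF inner q])
  ultimately have "hypersurface {x. r x = 0}" unfolding hypersurface_def by blast
  moreover have "S \<subseteq> {x. r x = 0}"
  proof
    fix x assume "x \<in> S"
    then obtain A where "A \<in> F" "x \<in> A" using F(3) by blast
    then have "q x = 0" unfolding q_def using F(1) p by (intro prod_zero) auto
    then show "x \<in> {x. r x = 0}" unfolding r_def by simp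
  qed
  ultimately show ?thesis by blast
qed

theorem theorem3p4:
  fixes C :: "(real ^ 'n) set" and \<nu> :: "real ^ 'n \<Rightarrow> real"
  assumes "C \<noteq> {}" and "closed C" and "semialgebraic C"
    and "is_norm \<nu>" and "semialgebraic_function \<nu>"
    and "\<nu> differentiable_on UNIV - {0}" and "dual_norm \<nu> differentiable_on UNIV - {0}"
  shows "semialgebraic (nonunique_points \<nu> C) \<and>
    (\<forall>U. open U \<and> U \<noteq> {} \<longrightarrow> \<not> U \<subseteq> nonunique_points \<nu> C) \<and>
    (\<exists>H. hypersurface H \<and> nonunique_points \<nu> C \<subseteq> H)"
proof -
  have thin: "\<not> U \<subseteq> nonunique_points \<nu> C" if "open U" "U \<noteq> {}" for U
    by (rule nonunique_points_no_open_subset[OF assms(4,2,6,7) that])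
  have "semialgebraic (nonunique_points \<nu> C)"
    by (rule semialgebraic_nonunique_points[OF assms(4,2,3,5)])
  then show ?thesis using thin thin_semialgebraic_subset_hypersurface[OF _ thin] by simp
qed

end
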